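(* Let $2<p<\infty$ and let $(x_n)_{n\in\mathbb N}$ be a normalized weakly null sequence in $JT_{2,p}$. Then $(x_n)_{n\in\mathbb N}$ has a subsequence which is either equivalent to the unit vector basis of $\ell_p$ or equivalent to the unit vector basis of $\ell_2$.
   Context: $\mathbb N=\{1,2,\dots\}$. Fix a partial order $\preceq$ on $\mathbb N$, compatible with the usual order ($n\preceq m$ implies $n\le m$), defining an infinitely branching tree without root: the predecessors of each element are linearly ordered, there are infinitely many minimal elements, and every element has infinitely many immediate successors. A segment is a set $\{k\in\mathbb N: m\preceq k\preceq n\}$ with $m\preceq n$. $c_{00}(\mathbb N)$ is the space of finitely supported real sequences. For $2<p<\infty$, $JT_{2,p}$ is the completion of $c_{00}(\mathbb N)$ under the norm $$\|x\|=\sup\Big\{\Big(\sum_{k=1}^n\Big(\sum_{i\in s_k}x(i)^2\Big)^{p/2}\Big)^{1/p}: n\in\mathbb N,\ s_1,\dots,s_n \text{ pairwise disjoint segments}\Big\}.$$ Two sequences $(x_n)$, $(z_n)$ are equivalent if there are $A,B>0$ with $A\|\sum a_nz_n\|\le\|\sum a_nx_n\|\le B\|\sum a_nz_n\|$ for all finitely supported real $(a_n)$. *)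

theory Defs
  imports "HOL-Analysis.Analysis" "HOL-Analysis.Finite_Function_Topology"
begin

text \<open>
  The index set \<open>{1, 2, \<dots>}\<close> is represented by the type \<^typ>\<open>nat\<close> (shifted by one); all notions below
  only use the order of the indices. The space \<open>c\<^sub>0\<^sub>0\<close> of finitely supported real sequences is the
  library type \<^typ>\<open>nat \<Rightarrow>\<^sub>0 real\<close>, of which only the vector space structure is used (the library also
  equips it with a norm, which plays no role here).
\<close>

definition tree_order :: "(nat \<Rightarrow> nat \<Rightarrow> bool) \<Rightarrow> bool" where
  "tree_order le \<longleftrightarrow>
     reflp le \<and> antisymp le \<and> transp le \<and>
     (\<forall>n m. le n m \<longrightarrow> n \<le> m) \<and>
     (\<forall>n. totalp_on {k. le k n} le) \<and>
     infinite {n. \<forall>k. le k n \<longrightarrow> k = n} \<and>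
     (\<forall>n. infinite {m. le n m \<and> m \<noteq> n \<and> (\<forall>k. le n k \<and> le k m \<longrightarrow> k = n \<or> k = m)})"

definition segment :: "(nat \<Rightarrow> nat \<Rightarrow> bool) \<Rightarrow> nat set \<Rightarrow> bool" where
  "segment le s \<longleftrightarrow> (\<exists>m n. le m n \<and> s = {k. le m k \<and> le k n})"

text \<open>The values whose supremum is the norm; see \<open>bdd_above_JT_values\<close> for boundedness.\<close>

definition JT_values :: "(nat \<Rightarrow> nat \<Rightarrow> bool) \<Rightarrow> real \<Rightarrow> (nat \<Rightarrow>\<^sub>0 real) \<Rightarrow> real set" where
  "JT_values le p x =
     {(\<Sum>k=1..n. (\<Sum>i\<in>s k. (Poly_Mapping.lookup x i)\<^sup>2) powr (p / 2)) powr (1 / p) | (n::nat) s.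
        1 \<le> n \<and> (\<forall>k\<in>{1..n}. segment le (s k)) \<and> disjoint_family_on s {1..n}}"

definition JT_norm :: "(nat \<Rightarrow> nat \<Rightarrow> bool) \<Rightarrow> real \<Rightarrow> (nat \<Rightarrow>\<^sub>0 real) \<Rightarrow> real" where
  "JT_norm le p x = Sup (JT_values le p x)"

text \<open>
  The Banach space \<open>'a\<close>, together with the embedding \<open>J\<close>, is a completion of the vector space \<open>'v\<close>
  under the norm \<open>N\<close>. The class \<^class>\<open>banach\<close> supplies the completeness.
\<close>

definition is_completion :: "('v::real_vector \<Rightarrow> real) \<Rightarrow> ('v \<Rightarrow> 'a::banach) \<Rightarrow> bool" where
  "is_completion N J \<longleftrightarrow> linear J \<and> (\<forall>v. norm (J v) = N v) \<and> closure (range J) = UNIV"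

definition weakly_null :: "(nat \<Rightarrow> 'a::real_normed_vector) \<Rightarrow> bool" where
  "weakly_null x \<longleftrightarrow> (\<forall>f::'a \<Rightarrow> real. bounded_linear f \<longrightarrow> (\<lambda>n. f (x n)) \<longlonglongrightarrow> 0)"

text \<open>
  Equivalence of a sequence \<open>x\<close> in a vector space with norm \<open>M\<close> and a sequence \<open>z\<close> in a vector
  space with norm \<open>N\<close>. The norms are explicit because \<open>\<ell>\<^sub>q\<close> depends on the real number \<open>q\<close>
  and so is not available as a type.
\<close>

definition equivalent_seqs ::
    "('a::real_vector \<Rightarrow> real) \<Rightarrow> (nat \<Rightarrow> 'a) \<Rightarrow> ('b::real_vector \<Rightarrow> real) \<Rightarrow> (nat \<Rightarrow> 'b) \<Rightarrow> bool" where
  "equivalent_seqs M x N z \<longleftrightarrow>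
     (\<exists>A>0. \<exists>B>0. \<forall>a :: nat \<Rightarrow>\<^sub>0 real.
        A * N (\<Sum>n\<in>Poly_Mapping.keys a. Poly_Mapping.lookup a n *\<^sub>R z n)
          \<le> M (\<Sum>n\<in>Poly_Mapping.keys a. Poly_Mapping.lookup a n *\<^sub>R x n) \<and>
        M (\<Sum>n\<in>Poly_Mapping.keys a. Poly_Mapping.lookup a n *\<^sub>R x n)
          \<le> B * N (\<Sum>n\<in>Poly_Mapping.keys a. Poly_Mapping.lookup a n *\<^sub>R z n))"

text \<open>
  The norm of \<open>\<ell>\<^sub>q\<close> restricted to finitely supported sequences. Equivalence to the unit vector basis
  only involves its finite linear combinations, which lie in \<open>c\<^sub>0\<^sub>0\<close>.
\<close>

definition lq_norm :: "real \<Rightarrow> (nat \<Rightarrow>\<^sub>0 real) \<Rightarrow> real" where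
  "lq_norm q x = (\<Sum>i\<in>Poly_Mapping.keys x. \<bar>Poly_Mapping.lookup x i\<bar> powr q) powr (1 / q)"

definition unit_vec :: "nat \<Rightarrow> (nat \<Rightarrow>\<^sub>0 real)" where
  "unit_vec n = Poly_Mapping.single n 1"

lemma finite_segment:
  assumes "tree_order le" "segment le s"
  shows "finite s"
proof -
  obtain m n where "s = {k. le m k \<and> le k n}"
    using assms(2) unfolding segment_def by blast
  then have "s \<subseteq> {..n}"
    using assms(1) unfolding tree_order_def by auto
  then show ?thesis
    using finite_subset by blast
qed

lemma JT_values_nonempty:
  assumes "tree_order le"
  shows "JT_values le p x \<noteq> {}"
proof -
  have "segment le {k. le 0 k \<and> le k 0}"
    using assms unfolding segment_def tree_order_def reflp_def by blast
  moreover have "disjoint_family_on s {1..Suc 0}" for s :: "nat \<Rightarrow> nat set"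
    by (auto simp: disjoint_family_on_def)
  ultimately have "\<exists>(n::nat) s. 1 \<le> n \<and> (\<forall>k\<in>{1..n}. segment le (s k)) \<and> disjoint_family_on s {1..n}"
    by (intro exI[of _ "Suc 0"] exI[of _ "\<lambda>_. {k. le 0 k \<and> le k 0}"]) auto
  then show ?thesis
    unfolding JT_values_def by blast
qed

lemma bdd_above_JT_values:
  assumes tree: "tree_order le" and p: "2 \<le> p"
  shows "bdd_above (JT_values le p x)"
proof -
  define K where "K = Poly_Mapping.keys x"
  define g where "g i = (Poly_Mapping.lookup x i)\<^sup>2" for i
  define T where "T = sum g K"
  have g0: "g i \<ge> 0" for i
    by (simp add: g_def)
  have finK: "finite K"
    by (simp add: K_def)
  have gz: "g i = 0" if "i \<notin> K" for i
    using that by (simp add: g_def K_def in_keys_iff)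
  have "(\<Sum>k=1..n. (\<Sum>i\<in>s k. g i) powr (p / 2)) powr (1 / p)
      \<le> (T * T powr (p / 2 - 1)) powr (1 / p)"
    if seg: "\<forall>k\<in>{1..n}. segment le (s k)" and disj: "disjoint_family_on s {1..n}"
    for n :: nat and s :: "nat \<Rightarrow> nat set"
  proof -
    define S where "S k = sum g (s k)" for k
    have fin: "finite (s k)" if "k \<in> {1..n}" for k
      using finite_segment[OF tree] seg that by blast
    have S0: "S k \<ge> 0" for k
      by (simp add: S_def g0 sum_nonneg)
    have le_T: "sum g A \<le> T" if "finite A" for A
    proof -
      have "sum g A = sum g (A \<inter> K)"
        using that by (intro sum.mono_neutral_right) (auto simp: gz)
      also have "\<dots> \<le> T"
        unfolding T_def using finK g0 by (intro sum_mono2) auto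
      finally show ?thesis .
    qed
    have "sum g (\<Union>k\<in>{1..n}. s k) = (\<Sum>k=1..n. S k)"
      unfolding S_def using fin disj
      by (intro sum.UNION_disjoint) (auto simp: disjoint_family_on_def)
    moreover have "finite (\<Union>k\<in>{1..n}. s k)"
      using fin by blast
    ultimately have sumS: "(\<Sum>k=1..n. S k) \<le> T"
      using le_T by metis
    have "S k powr (p / 2) \<le> S k * T powr (p / 2 - 1)" if k: "k \<in> {1..n}" for k
    proof (cases "S k = 0")
      case False
      have "S k powr (p / 2) = S k powr (1 + (p / 2 - 1))"
        by simp
      also have "\<dots> = S k * S k powr (p / 2 - 1)"
        using S0[of k] False by (subst powr_add) simp
      also have "\<dots> \<le> S k * T powr (p / 2 - 1)"
        using le_T[OF fin[OF k]] S0[of k] p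
        by (intro mult_left_mono powr_mono2) (auto simp: S_def)
      finally show ?thesis .
    qed simp
    then have "(\<Sum>k=1..n. S k powr (p / 2)) \<le> (\<Sum>k=1..n. S k * T powr (p / 2 - 1))"
      by (rule sum_mono)
    also have "\<dots> = (\<Sum>k=1..n. S k) * T powr (p / 2 - 1)"
      by (simp add: sum_distrib_right)
    also have "\<dots> \<le> T * T powr (p / 2 - 1)"
      using sumS by (intro mult_right_mono) auto
    finally show ?thesis
      unfolding S_def using p by (intro powr_mono2 sum_nonneg) auto
  qed
  then show ?thesis
    unfolding JT_values_def g_def by (intro bdd_aboveI) blast
qed

end

theory Submission
  imports Defs
begin

text \<open>
  A gliding hump replaces the sequence, along a subsequence, by successive finitely supported
  blocks \<open>u\<^sub>n\<close>. The square of the norm is a supremum of \<open>\<ell>\<^bsub>p/2\<^esub>\<close> norms of the square masses on disjoint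
  segments, so blocks always satisfy an upper \<open>\<ell>\<^sub>2\<close> estimate; since a segment cut down to
  an interval is a segment, they also satisfy a lower \<open>\<ell>\<^sub>p\<close> estimate. If infinitely many blocks have
  mass at least \<open>d > 0\<close> on one chain, this chain gives the lower \<open>\<ell>\<^sub>2\<close> estimate. Otherwise the mass of
  \<open>u\<^sub>n\<close> on every chain tends to 0, and a subsequence can be chosen such that no segment is heavy on two
  blocks beyond the \<open>k\<close>-th one, where the meaning of heavy depends on the support of the \<open>k\<close>-th block.
  On a segment whose first block is the \<open>k\<close>-th, a combination is then dominated by this block, at most
  one heavy later block, and an error that is summable over disjoint segments; this is the upper
  \<open>\<ell>\<^sub>p\<close> estimate.
\<close>

section \<open>Finitely supported functions, choice of subsequences, extension to a
  completion\<close>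

lemma lookup_scaleR: "Poly_Mapping.lookup (c *\<^sub>R v) i = c * Poly_Mapping.lookup v i"
  for v :: "'a \<Rightarrow>\<^sub>0 real"
proof -
  have "finite {i. c * Poly_Mapping.lookup v i \<noteq> 0}"
    by (rule finite_subset[OF _ finite_keys[of v]]) (auto simp: in_keys_iff)
  then show ?thesis
    by (simp add: scaleR_poly_mapping_def)
qed

lemma scaleR_unit_vec: "c *\<^sub>R unit_vec n = Poly_Mapping.single n c"
  by (rule poly_mapping_eqI) (simp add: lookup_scaleR unit_vec_def lookup_single when_def)

lemma sum_scaleR_unit_vec:
  "(\<Sum>n\<in>Poly_Mapping.keys a. Poly_Mapping.lookup a n *\<^sub>R unit_vec n) = a"
  by (rule poly_mapping_eqI)
     (auto simp: lookup_sum scaleR_unit_vec lookup_single when_def in_keys_iff)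

text \<open>Sequential compactness of the \<open>{0, 1}\<close>-valued functions on a countable set,
  applied to indicator functions.\<close>

lemma pointwise_convergent_subseq_of_sets:
  fixes T :: "nat \<Rightarrow> 'i::countable \<Rightarrow> 'k::countable set"
  obtains r :: "nat \<Rightarrow> nat" and L :: "'i \<Rightarrow> 'k set"
  where "strict_mono r" "\<And>i k. eventually (\<lambda>m. k \<in> T (r m) i \<longleftrightarrow> k \<in> L i) sequentially"
proof -
  define f :: "nat \<Rightarrow> 'i \<times> 'k \<Rightarrow> real" where "f m = (\<lambda>(i, k). indicator (T m i) k)" for m
  have "compactin (product_topology (\<lambda>_. euclidean) UNIV) (PiE UNIV (\<lambda>_::'i \<times> 'k. {0, 1::real}))"
    by (subst compactin_PiE) auto
  then have "compact (PiE UNIV (\<lambda>_::'i \<times> 'k. {0, 1::real}))"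
    by (simp add: euclidean_product_topology)
  then have "seq_compact (PiE UNIV (\<lambda>_::'i \<times> 'k. {0, 1::real}))"
    by (rule compact_imp_seq_compact)
  moreover have "f m \<in> PiE UNIV (\<lambda>_::'i \<times> 'k. {0, 1::real})" for m
    by (auto simp: f_def indicator_def)
  ultimately obtain g r where g: "g \<in> PiE UNIV (\<lambda>_::'i \<times> 'k. {0, 1::real})" "strict_mono r"
    "(f \<circ> r) \<longlonglongrightarrow> g"
    unfolding seq_compact_def by meson
  have "eventually (\<lambda>m. k \<in> T (r m) i \<longleftrightarrow> k \<in> {k. g (i, k) = 1}) sequentially" for i k
  proof -
    have "isCont (\<lambda>h::'i \<times> 'k \<Rightarrow> real. h (i, k)) g"
      using continuous_on_product_coordinates[of "(i, k)"] continuous_on_eq_continuous_at by blast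
    then have "(\<lambda>m. (f \<circ> r) m (i, k)) \<longlonglongrightarrow> g (i, k)"
      using g(3) by (rule isCont_tendsto_compose)
    then have "eventually (\<lambda>m. dist ((f \<circ> r) m (i, k)) (g (i, k)) < 1) sequentially"
      by (rule tendstoD) simp
    moreover have "g (i, k) = 0 \<or> g (i, k) = 1"
      using g(1) by auto
    ultimately show ?thesis
      by (auto elim!: eventually_mono simp: f_def dist_real_def indicator_def split: if_splits)
  qed
  with g(2) show ?thesis
    by (rule that)
qed

text \<open>Each index is chosen beyond the threshold of its predecessor; monotonicity carries that
  threshold to all later indices.\<close>

lemma strict_mono_of_eventual:
  fixes P :: "nat \<Rightarrow> nat \<Rightarrow> bool"
  assumes "\<And>j. eventually (P j) sequentially"
  shows "\<exists>r::nat \<Rightarrow> nat. strict_mono r \<and> (\<forall>l n. l < n \<longrightarrow> P (r l) (r n))"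
proof -
  obtain M where M: "\<And>j m. m \<ge> M j \<Longrightarrow> P j m"
    using assms unfolding eventually_sequentially by metis
  have "\<exists>y. True \<and> (M x \<le> y \<and> x < y)" for x
    by (intro exI[of _ "max (M x) (Suc x)"]) auto
  then obtain r where r: "\<And>l. M (r l) \<le> r (Suc l) \<and> r l < r (Suc l)"
    using dependent_nat_choice[of "\<lambda>_ _. True" "\<lambda>_ x y. M x \<le> y \<and> x < y"] by auto
  have mono: "strict_mono r"
    using r by (simp add: strict_mono_Suc_iff)
  have "P (r l) (r n)" if "l < n" for l n
  proof (rule M)
    have "r (Suc l) \<le> r n"
      using mono that by (simp add: strict_mono_less_eq Suc_leI)
    then show "M (r l) \<le> r n"
      using r[of l] by linarith
  qed
  then show ?thesis
    using mono by auto
qed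

text \<open>Turns coordinates into functionals on the completion, where weak nullness can be tested.
  The one estimate in the conclusion yields both agreement with \<open>g\<close> (at
  \<open>y = J v\<close>) and boundedness (at \<open>v = 0\<close>).\<close>

lemma bounded_linear_extension_to_completion:
  fixes J :: "'v::real_vector \<Rightarrow> 'a::banach" and g :: "'v \<Rightarrow> real"
  assumes comp: "is_completion N J" and lin: "linear g" and bound: "\<And>v. \<bar>g v\<bar> \<le> N v"
  obtains f where "bounded_linear f" "\<And>y v. \<bar>f y - g v\<bar> \<le> norm (y - J v)"
proof -
  have J: "linear J" "\<And>v. norm (J v) = N v" "closure (range J) = UNIV"
    using comp by (auto simp: is_completion_def)
  have gJ: "\<bar>g v - g w\<bar> \<le> norm (J v - J w)" for v w
    using bound[of "v - w"] J(2)[of "v - w"] by (simp add: linear_diff[OF lin] linear_diff[OF J(1)])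
  have dense: "\<exists>v. norm (y - J v) < e" if "e > 0" for y e
  proof -
    have "y \<in> closure (range J)"
      using J(3) by simp
    then show ?thesis
      using that unfolding closure_approachable by (force simp: dist_norm norm_minus_commute)
  qed
  \<comment> \<open>The value at \<open>y\<close> is the limit of \<open>g\<close> along a sequence
    in \<open>range J\<close> converging to \<open>y\<close>; the Lipschitz estimate
    \<open>gJ\<close> passes to this limit.\<close>
  have "\<exists>c. \<forall>v. \<bar>c - g v\<bar> \<le> norm (y - J v)" for y
  proof -
    have "y \<in> closure (range J)"
      using J(3) by simp
    then obtain z where z: "\<And>n. z n \<in> range J" "z \<longlonglongrightarrow> y"
      unfolding closure_sequential by auto
    have "\<forall>n. \<exists>v. z n = J v"
      using z(1) by auto
    then obtain w where w: "\<And>n. z n = J (w n)"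
      by metis
    have "Cauchy (\<lambda>n. g (w n))"
    proof (rule metric_CauchyI)
      fix e :: real assume "e > 0"
      then obtain M where M: "\<And>m n. m \<ge> M \<Longrightarrow> n \<ge> M \<Longrightarrow> dist (z m) (z n) < e"
        using LIMSEQ_imp_Cauchy[OF z(2)] unfolding Cauchy_def by meson
      have "dist (g (w m)) (g (w n)) < e" if "m \<ge> M" "n \<ge> M" for m n
        using gJ[of "w m" "w n"] M[OF that] by (simp add: dist_norm w)
      then show "\<exists>M. \<forall>m\<ge>M. \<forall>n\<ge>M. dist (g (w m)) (g (w n)) < e"
        by blast
    qed
    then obtain c where c: "(\<lambda>n. g (w n)) \<longlonglongrightarrow> c"
      using Cauchy_convergent unfolding convergent_def by blast
    have "\<bar>c - g v\<bar> \<le> norm (y - J v)" for v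
    proof (rule LIMSEQ_le)
      show "(\<lambda>n. \<bar>g (w n) - g v\<bar>) \<longlonglongrightarrow> \<bar>c - g v\<bar>"
        by (intro tendsto_intros c)
      show "(\<lambda>n. norm (z n - J v)) \<longlonglongrightarrow> norm (y - J v)"
        by (intro tendsto_intros z)
    qed (use gJ w in auto)
    then show ?thesis
      by blast
  qed
  then obtain f where f: "\<And>y v. \<bar>f y - g v\<bar> \<le> norm (y - J v)"
    by metis
  have "f (x + y) = f x + f y" for x y
  proof (rule ccontr)
    \<comment> \<open>The approximations of \<open>x\<close> and \<open>y\<close> cost less than
      \<open>e\<close> each and that of \<open>x + y\<close> less than \<open>2 * e\<close>, hence
      the divisor 4.\<close>
    define e where "e = \<bar>f (x + y) - (f x + f y)\<bar> / 4"
    assume "f (x + y) \<noteq> f x + f y"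
    then have e: "e > 0"
      by (simp add: e_def)
    obtain v w where v: "norm (x - J v) < e" and w: "norm (y - J w) < e"
      using dense[OF e] by blast
    have "norm ((x - J v) + (y - J w)) \<le> norm (x - J v) + norm (y - J w)"
      by (rule norm_triangle_ineq)
    then have "norm (x + y - J (v + w)) < 2 * e"
      using v w by (simp add: linear_add[OF J(1)] algebra_simps)
    then have "\<bar>f (x + y) - (g v + g w)\<bar> < 2 * e"
      using f[of "x + y" "v + w"] by (simp add: linear_add[OF lin])
    then show False
      using f[of x v] f[of y w] v w unfolding e_def by argo
  qed
  moreover have "f (c *\<^sub>R x) = c *\<^sub>R f x" for c x
  proof (rule ccontr)
    \<comment> \<open>The two approximation errors add up to at most
      \<open>2 * \<bar>c\<bar> * e\<close>; the summand 1 makes the final inequality strict, also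
      for \<open>c = 0\<close>.\<close>
    define e where "e = \<bar>f (c *\<^sub>R x) - c * f x\<bar> / (2 * (\<bar>c\<bar> + 1))"
    assume "f (c *\<^sub>R x) \<noteq> c *\<^sub>R f x"
    then have e: "e > 0"
      by (auto simp: e_def intro!: divide_pos_pos)
    obtain v where v: "norm (x - J v) < e"
      using dense[OF e] by blast
    have "norm (c *\<^sub>R x - J (c *\<^sub>R v)) = \<bar>c\<bar> * norm (x - J v)"
      by (simp add: linear_scale[OF J(1)] flip: scaleR_diff_right)
    also have "\<dots> \<le> \<bar>c\<bar> * e"
      using v by (intro mult_left_mono) auto
    finally have 1: "\<bar>f (c *\<^sub>R x) - c * g v\<bar> \<le> \<bar>c\<bar> * e"
      using f[of "c *\<^sub>R x" "c *\<^sub>R v"] by (simp add: linear_scale[OF lin])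
    have "\<bar>c * f x - c * g v\<bar> = \<bar>c\<bar> * \<bar>f x - g v\<bar>"
      by (simp add: abs_mult flip: right_diff_distrib)
    also have "\<dots> \<le> \<bar>c\<bar> * e"
      using f[of x v] v by (intro mult_left_mono) auto
    finally have "\<bar>f (c *\<^sub>R x) - c * f x\<bar> \<le> 2 * \<bar>c\<bar> * e"
      using 1 by linarith
    also have "\<dots> < 2 * (\<bar>c\<bar> + 1) * e"
      using e by (simp add: algebra_simps)
    also have "\<dots> = \<bar>f (c *\<^sub>R x) - c * f x\<bar>"
      unfolding e_def by (simp add: field_simps)
    finally show False
      by simp
  qed
  moreover have "norm (f x) \<le> norm x * 1" for x
    using f[of x 0] by (simp add: linear_0[OF lin] linear_0[OF J(1)])
  ultimately have "bounded_linear f"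
    by (intro bounded_linear_intro)
  then show ?thesis
    using f that by blast
qed

section \<open>Finite sums in ell_q and small perturbations\<close>

lemma lq_norm_nonneg: "0 \<le> lq_norm q a"
  by (simp add: lq_norm_def)

lemma lq_norm_powr:
  assumes "q > 0"
  shows "lq_norm q a powr q = (\<Sum>n\<in>Poly_Mapping.keys a. \<bar>Poly_Mapping.lookup a n\<bar> powr q)"
  using assms by (simp add: lq_norm_def powr_powr sum_nonneg)

lemma abs_lookup_le_lq_norm:
  assumes "q > 0" "n \<in> Poly_Mapping.keys a"
  shows "\<bar>Poly_Mapping.lookup a n\<bar> \<le> lq_norm q a"
proof -
  have "\<bar>Poly_Mapping.lookup a n\<bar> = (\<bar>Poly_Mapping.lookup a n\<bar> powr q) powr (1 / q)"
    using assms by (simp add: powr_powr)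
  also have "\<dots> \<le> lq_norm q a"
    unfolding lq_norm_def using assms
    by (intro powr_mono2 member_le_sum) auto
  finally show ?thesis .
qed

text \<open>Every coefficient is bounded by \<open>lq_norm q a\<close>, so passing from
  \<open>y\<close> to \<open>x\<close> changes a combination by at most
  \<open>c / 2 * lq_norm q a\<close>, and half of the lower estimate survives.\<close>

lemma equivalent_seqs_perturbation:
  fixes x y :: "nat \<Rightarrow> 'a::real_normed_vector"
  assumes q: "q > 0" and c: "c > 0" and D: "D > 0"
    and err: "\<And>F. finite F \<Longrightarrow> (\<Sum>n\<in>F. norm (x n - y n)) \<le> c / 2"
    and lower: "\<And>a. c * lq_norm q a \<le>
      norm (\<Sum>n\<in>Poly_Mapping.keys a. Poly_Mapping.lookup a n *\<^sub>R y n)"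
    and upper: "\<And>a. norm (\<Sum>n\<in>Poly_Mapping.keys a. Poly_Mapping.lookup a n *\<^sub>R y n) \<le> D * lq_norm q a"
  shows "equivalent_seqs norm x (lq_norm q) unit_vec"
proof -
  have diff: "norm ((\<Sum>n\<in>Poly_Mapping.keys a. Poly_Mapping.lookup a n *\<^sub>R x n) -
      (\<Sum>n\<in>Poly_Mapping.keys a. Poly_Mapping.lookup a n *\<^sub>R y n)) \<le> c / 2 * lq_norm q a" (is "?l \<le> _") for a
  proof -
    have "?l = norm (\<Sum>n\<in>Poly_Mapping.keys a. Poly_Mapping.lookup a n *\<^sub>R (x n - y n))"
      by (simp add: scaleR_diff_right sum_subtractf)
    also have "\<dots> \<le> (\<Sum>n\<in>Poly_Mapping.keys a. norm (Poly_Mapping.lookup a n *\<^sub>R (x n - y n)))"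
      by (rule norm_sum)
    also have "\<dots> \<le> (\<Sum>n\<in>Poly_Mapping.keys a. lq_norm q a * norm (x n - y n))"
      by (intro sum_mono) (auto intro!: mult_right_mono abs_lookup_le_lq_norm q)
    also have "\<dots> = (\<Sum>n\<in>Poly_Mapping.keys a. norm (x n - y n)) * lq_norm q a"
      by (simp add: sum_distrib_left mult.commute)
    also have "\<dots> \<le> c / 2 * lq_norm q a"
      by (intro mult_right_mono err lq_norm_nonneg) auto
    finally show ?thesis .
  qed
  have "c / 2 * lq_norm q a \<le> norm (\<Sum>n\<in>Poly_Mapping.keys a. Poly_Mapping.lookup a n *\<^sub>R x n) \<and>
    norm (\<Sum>n\<in>Poly_Mapping.keys a. Poly_Mapping.lookup a n *\<^sub>R x n) \<le> (D + c / 2) * lq_norm q a"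
    (is "_ \<le> norm ?x \<and> _") for a
  proof -
    let ?y = "\<Sum>n\<in>Poly_Mapping.keys a. Poly_Mapping.lookup a n *\<^sub>R y n"
    have "norm ?x \<le> norm ?y + norm (?x - ?y)" "norm ?y \<le> norm ?x + norm (?x - ?y)"
      using norm_triangle_sub[of ?x ?y] norm_triangle_sub[of ?y ?x] by (auto simp: norm_minus_commute)
    then show ?thesis
      using diff[of a] lower[of a] upper[of a] by (simp add: algebra_simps)
  qed
  then show ?thesis
    unfolding equivalent_seqs_def sum_scaleR_unit_vec using c D
    by (intro exI[of _ "c / 2"] exI[of _ "D + c / 2"] conjI) auto
qed

section \<open>Square masses and the norm\<close>

text \<open>The intersection with the support keeps the sum finite, so that \<open>A\<close> may be
  an infinite chain.\<close>

definition sq_mass :: "(nat \<Rightarrow>\<^sub>0 real) \<Rightarrow> nat set \<Rightarrow> real" where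
  "sq_mass v A = (\<Sum>i\<in>Poly_Mapping.keys v \<inter> A. (Poly_Mapping.lookup v i)\<^sup>2)"

lemma sq_mass_nonneg [simp]: "0 \<le> sq_mass v A"
  by (simp add: sq_mass_def sum_nonneg)

lemma sq_mass_empty [simp]: "sq_mass v {} = 0"
  by (simp add: sq_mass_def)

lemma sq_mass_mono:
  assumes "Poly_Mapping.keys v \<inter> A \<subseteq> B"
  shows "sq_mass v A \<le> sq_mass v B"
  unfolding sq_mass_def using assms by (intro sum_mono2) auto

lemma sq_mass_finite:
  assumes "finite A"
  shows "(\<Sum>i\<in>A. (Poly_Mapping.lookup v i)\<^sup>2) = sq_mass v A"
  unfolding sq_mass_def using assms by (intro sum.mono_neutral_right) (auto simp: in_keys_iff)

lemma sq_mass_pos_imp: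
  assumes "sq_mass v A \<noteq> 0"
  obtains i where "i \<in> Poly_Mapping.keys v" "i \<in> A"
proof -
  have "Poly_Mapping.keys v \<inter> A \<noteq> {}"
    using assms by (auto simp: sq_mass_def)
  then show ?thesis
    using that by blast
qed

definition lin_comb :: "(nat \<Rightarrow>\<^sub>0 real) \<Rightarrow> (nat \<Rightarrow> 'b::real_vector) \<Rightarrow> 'b" where
  "lin_comb a u = (\<Sum>n\<in>Poly_Mapping.keys a. Poly_Mapping.lookup a n *\<^sub>R u n)"

text \<open>The intervals are kept as data because segments are cut down to them. Their nonemptiness
  makes \<open>hi\<close> strictly increasing even if some blocks vanish.\<close>

definition block_seq :: "(nat \<Rightarrow> nat) \<Rightarrow> (nat \<Rightarrow> nat) \<Rightarrow> (nat \<Rightarrow> nat \<Rightarrow>\<^sub>0 real) \<Rightarrow> bool" where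
  "block_seq lo hi u \<longleftrightarrow>
     (\<forall>n. Poly_Mapping.keys (u n) \<subseteq> {lo n..<hi n} \<and> lo n < hi n) \<and> (\<forall>m n. m < n \<longrightarrow> hi m \<le> lo n)"

lemma block_seqD:
  assumes "block_seq lo hi u"
  shows "Poly_Mapping.keys (u n) \<subseteq> {lo n..<hi n}" "lo n < hi n" "m < n \<Longrightarrow> hi m \<le> lo n"
  using assms by (auto simp: block_seq_def)

lemma block_seq_subseq:
  assumes "block_seq lo hi u" "strict_mono r"
  shows "block_seq (lo \<circ> r) (hi \<circ> r) (u \<circ> r)"
  using assms by (auto simp: block_seq_def strict_mono_def)

lemma block_seq_inj:
  assumes "block_seq lo hi u" "i \<in> {lo m..<hi m}" "i \<in> {lo n..<hi n}"
  shows "m = n"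
  using assms block_seqD(3)[OF assms(1), of m n] block_seqD(3)[OF assms(1), of n m]
  by (cases m n rule: linorder_cases) auto

lemma block_seq_hi_strict_mono:
  assumes "block_seq lo hi u"
  shows "strict_mono hi"
  using block_seqD(2,3)[OF assms] by (meson le_less_trans strict_monoI)

text \<open>Blocks have disjoint supports, so at each node at most one term is nonzero and squaring
  produces no mixed terms.\<close>

lemma sq_mass_lin_comb:
  assumes "block_seq lo hi u"
  shows "sq_mass (lin_comb a u) A =
    (\<Sum>n\<in>Poly_Mapping.keys a. (Poly_Mapping.lookup a n)\<^sup>2 * sq_mass (u n) A)"
proof -
  let ?K = "Poly_Mapping.keys a"
  have look: "Poly_Mapping.lookup (lin_comb a u) i = Poly_Mapping.lookup a n * Poly_Mapping.lookup (u n) i"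
    if "n \<in> ?K" "i \<in> Poly_Mapping.keys (u n)" for n i
  proof -
    have "Poly_Mapping.lookup (lin_comb a u) i =
        (\<Sum>m\<in>?K. Poly_Mapping.lookup a m * Poly_Mapping.lookup (u m) i)"
      by (simp add: lin_comb_def lookup_sum lookup_scaleR)
    also have "\<dots> = (\<Sum>m\<in>{n}. Poly_Mapping.lookup a m * Poly_Mapping.lookup (u m) i)"
    proof (intro sum.mono_neutral_right ballI)
      fix m assume "m \<in> ?K - {n}"
      then have "i \<notin> Poly_Mapping.keys (u m)"
        using block_seq_inj[OF assms, of i m n] block_seqD(1)[OF assms] that by blast
      then show "Poly_Mapping.lookup a m * Poly_Mapping.lookup (u m) i = 0"
        by (simp add: in_keys_iff)
    qed (use that in auto)
    finally show ?thesis
      by simp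
  qed
  have sub: "Poly_Mapping.keys (lin_comb a u) \<subseteq> (\<Union>n\<in>?K. Poly_Mapping.keys (u n))"
  proof (rule subsetI, rule ccontr)
    fix i assume "i \<in> Poly_Mapping.keys (lin_comb a u)" "i \<notin> (\<Union>n\<in>?K. Poly_Mapping.keys (u n))"
    then show False
      by (simp add: lin_comb_def in_keys_iff lookup_sum lookup_scaleR)
  qed
  have "sq_mass (lin_comb a u) A =
      (\<Sum>i\<in>(\<Union>n\<in>?K. Poly_Mapping.keys (u n) \<inter> A). (Poly_Mapping.lookup (lin_comb a u) i)\<^sup>2)"
    unfolding sq_mass_def using sub by (intro sum.mono_neutral_left) (auto simp: in_keys_iff)
  also have "\<dots> = (\<Sum>n\<in>?K. \<Sum>i\<in>Poly_Mapping.keys (u n) \<inter> A. (Poly_Mapping.lookup (lin_comb a u) i)\<^sup>2)"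
  proof (intro sum.UNION_disjoint ballI impI)
    fix m n :: nat assume "m \<noteq> n"
    then have "\<And>i. i \<in> Poly_Mapping.keys (u m) \<Longrightarrow> i \<notin> Poly_Mapping.keys (u n)"
      using block_seq_inj[OF assms, of _ m n] block_seqD(1)[OF assms] by blast
    then show "(Poly_Mapping.keys (u m) \<inter> A) \<inter> (Poly_Mapping.keys (u n) \<inter> A) = {}"
      by blast
  qed auto
  also have "\<dots> = (\<Sum>n\<in>?K. (Poly_Mapping.lookup a n)\<^sup>2 * sq_mass (u n) A)"
    by (intro sum.cong refl) (auto simp: sq_mass_def look sum_distrib_left power_mult_distrib)
  finally show ?thesis .
qed

section \<open>Segments, chains and admissible families\<close>

locale James_tree =
  fixes le :: "nat \<Rightarrow> nat \<Rightarrow> bool" and p :: real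
  assumes tree: "tree_order le" and p_gt_2: "2 < p"
begin

lemma le_refl: "le i i"
  using tree by (auto simp: tree_order_def reflp_def)

lemma le_trans: "le i j \<Longrightarrow> le j k \<Longrightarrow> le i k"
  using tree by (auto simp: tree_order_def dest: transpD)

lemma le_imp_le: "le i j \<Longrightarrow> i \<le> j"
  using tree by (auto simp: tree_order_def)

lemma pred_total: "le i k \<Longrightarrow> le j k \<Longrightarrow> i \<le> j \<Longrightarrow> le i j"
proof -
  assume a: "le i k" "le j k" "i \<le> j"
  have "totalp_on {i. le i k} le"
    using tree by (auto simp: tree_order_def)
  then have "i = j \<or> le i j \<or> le j i"
    using a unfolding totalp_on_def by blast
  then show ?thesis
    using a(3) le_imp_le[of j i] le_refl by auto
qed

text \<open>The tree order is compatible with the usual order, which therefore already fixes the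
  direction of each comparison. Infinite chains are allowed.\<close>

definition chain_set :: "nat set \<Rightarrow> bool" where
  "chain_set T \<longleftrightarrow> (\<forall>i\<in>T. \<forall>j\<in>T. i \<le> j \<longrightarrow> le i j)"

lemma chain_set_preds: "chain_set {i. le i k}"
  unfolding chain_set_def using pred_total by blast

text \<open>The segment between the least and the greatest element of \<open>B\<close>
  works.\<close>

lemma chain_subset_segment:
  assumes "chain_set T" "finite B" "B \<noteq> {}" "B \<subseteq> T"
  shows "\<exists>s. segment le s \<and> B \<subseteq> s"
proof -
  have in_B: "Min B \<in> B" "Max B \<in> B"
    using assms by auto
  then have "le (Min B) (Max B)"
    using assms Min_le[of B "Max B"] unfolding chain_set_def by blast
  then have "segment le {k. le (Min B) k \<and> le k (Max B)}"
    unfolding segment_def by blast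
  moreover have "B \<subseteq> {k. le (Min B) k \<and> le k (Max B)}"
    using assms in_B Min_le[of B] Max_ge[of B] unfolding chain_set_def by blast
  ultimately show ?thesis
    by blast
qed

text \<open>Below the upper end of \<open>s\<close> the tree order coincides with the usual one, so
  the part in the interval is the segment from its minimum to its maximum.\<close>

lemma segment_Int_interval:
  assumes "segment le s"
  shows "segment le (s \<inter> {lo..<hi}) \<or> s \<inter> {lo..<hi} = {}"
proof (cases "s \<inter> {lo..<hi} = {}")
  case False
  define B where "B = s \<inter> {lo..<hi}"
  obtain m M where s: "s = {k. le m k \<and> le k M}"
    using assms unfolding segment_def by blast
  have fin: "finite B" and ne: "B \<noteq> {}"
    using False by (auto simp: B_def)
  have in_s: "Min B \<in> B" "Max B \<in> B"
    using fin ne by auto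
  have "B = {k. le (Min B) k \<and> le k (Max B)}"
  proof (intro equalityI subsetI)
    fix k assume k: "k \<in> B"
    then have "Min B \<le> k" "k \<le> Max B"
      using fin by auto
    then show "k \<in> {k. le (Min B) k \<and> le k (Max B)}"
      using k in_s pred_total[of _ M] unfolding B_def s by auto
  next
    fix k assume k: "k \<in> {k. le (Min B) k \<and> le k (Max B)}"
    then have "Min B \<le> k" "k \<le> Max B"
      using le_imp_le by auto
    moreover have "k \<in> s"
      using in_s k le_trans unfolding B_def s by blast
    ultimately show "k \<in> B"
      using in_s unfolding B_def by auto
  qed
  moreover have "le (Min B) (Max B)"
    using in_s pred_total[of "Min B" M "Max B"] fin ne unfolding B_def s by auto
  ultimately show ?thesis
    unfolding segment_def B_def by blast
qed simp

text \<open>Empty sets are admitted so that restricting a family to an interval keeps it admissible.\<close>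

definition seg_family :: "'i set \<Rightarrow> ('i \<Rightarrow> nat set) \<Rightarrow> bool" where
  "seg_family I s \<longleftrightarrow> finite I \<and> (\<forall>k\<in>I. segment le (s k) \<or> s k = {}) \<and> disjoint_family_on s I"

text \<open>The \<open>p\<close>-th power of a value competing in the norm. Without the outer root,
  sums over families can be combined and interchanged with sums over blocks.\<close>

definition family_sum :: "(nat \<Rightarrow>\<^sub>0 real) \<Rightarrow> 'i set \<Rightarrow> ('i \<Rightarrow> nat set) \<Rightarrow> real" where
  "family_sum v I s = (\<Sum>k\<in>I. sq_mass v (s k) powr (p / 2))"

lemma family_sum_nonneg: "0 \<le> family_sum v I s"
  by (simp add: family_sum_def sum_nonneg)

lemma JT_values_conv:
  "JT_values le p v = {family_sum v {1..n} s powr (1 / p) | (n::nat) s.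
      1 \<le> n \<and> (\<forall>k\<in>{1..n}. segment le (s k)) \<and> disjoint_family_on s {1..n}}"
proof -
  have "(\<Sum>k=1..n. (\<Sum>i\<in>s k. (Poly_Mapping.lookup v i)\<^sup>2) powr (p / 2)) = family_sum v {1..n} s"
    if "\<forall>k\<in>{1..n}. segment le (s k)" for n :: nat and s
    unfolding family_sum_def using that finite_segment[OF tree]
    by (intro sum.cong refl) (simp add: sq_mass_finite)
  then show ?thesis
    unfolding JT_values_def by (intro Collect_cong) metis
qed

text \<open>Empty members contribute nothing, and the others are renumbered by
  \<open>{1..card I'}\<close> to match the definition of the norm. The norm asks for at least one
  segment, so the case without any is separate.\<close>

lemma family_sum_le_JT_norm:
  assumes "seg_family I s"
  shows "family_sum v I s \<le> JT_norm le p v powr p"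
proof -
  define I' where "I' = {k\<in>I. s k \<noteq> {}}"
  have fin: "finite I'"
    using assms by (simp add: I'_def seg_family_def)
  have seg_I': "segment le (s k)" if "k \<in> I'" for k
    using that assms by (auto simp: I'_def seg_family_def)
  have disj_I': "s k \<inter> s l = {}" if "k \<in> I'" "l \<in> I'" "k \<noteq> l" for k l
    using that assms by (auto simp: I'_def seg_family_def disjoint_family_on_def)
  have eq: "family_sum v I s = family_sum v I' s"
    unfolding family_sum_def I'_def using assms
    by (intro sum.mono_neutral_right) (auto simp: seg_family_def)
  show ?thesis
  proof (cases "I' = {}")
    case True
    then show ?thesis
      unfolding eq by (simp add: family_sum_def)
  next
    case False
    then have card: "1 \<le> card I'"
      using fin by (simp add: Suc_le_eq card_gt_0_iff)
    obtain e where e: "bij_betw e {1..card I'} I'"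
      using ex_bij_betw_nat_finite_1[OF fin] by blast
    have mem: "e k \<in> I'" if "k \<in> {1..card I'}" for k
      using e that by (auto simp: bij_betw_def)
    have disj: "disjoint_family_on (s \<circ> e) {1..card I'}"
      unfolding disjoint_family_on_def
    proof (intro ballI impI)
      fix k l assume kl: "k \<in> {1..card I'}" "l \<in> {1..card I'}" "k \<noteq> l"
      then have "e k \<noteq> e l"
        using bij_betw_imp_inj_on[OF e] by (meson inj_onD)
      then show "(s \<circ> e) k \<inter> (s \<circ> e) l = {}"
        using disj_I' mem[OF kl(1)] mem[OF kl(2)] by simp
    qed
    have "\<forall>k\<in>{1..card I'}. segment le ((s \<circ> e) k)"
    proof
      fix k assume "k \<in> {1..card I'}"
      then show "segment le ((s \<circ> e) k)"
        using seg_I' mem by simp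
    qed
    with disj have "family_sum v {1..card I'} (s \<circ> e) powr (1 / p) \<in> JT_values le p v"
      unfolding JT_values_conv using card
      by (intro CollectI exI[of _ "card I'"] exI[of _ "s \<circ> e"] conjI refl)
    then have "family_sum v {1..card I'} (s \<circ> e) powr (1 / p) \<le> JT_norm le p v"
      unfolding JT_norm_def using bdd_above_JT_values[OF tree] p_gt_2 by (intro cSup_upper) auto
    moreover have "family_sum v {1..card I'} (s \<circ> e) = family_sum v I' s"
      unfolding family_sum_def
      using sum.reindex_bij_betw[OF e, of "\<lambda>k. sq_mass v (s k) powr (p / 2)"] by simp
    ultimately have "family_sum v I s powr (1 / p) \<le> JT_norm le p v"
      by (simp add: eq)
    then have "(family_sum v I s powr (1 / p)) powr p \<le> JT_norm le p v powr p"
      using p_gt_2 by (intro powr_mono2) auto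
    then show ?thesis
      using p_gt_2 by (simp add: powr_powr family_sum_nonneg)
  qed
qed

lemma JT_norm_le:
  assumes "0 \<le> C" "\<And>(n::nat) s. seg_family {1..n} s \<Longrightarrow> family_sum v {1..n} s \<le> C powr p"
  shows "JT_norm le p v \<le> C"
  unfolding JT_norm_def
proof (rule cSup_least[OF JT_values_nonempty[OF tree]])
  fix y assume "y \<in> JT_values le p v"
  then obtain n :: nat and s where y: "y = family_sum v {1..n} s powr (1 / p)" and s: "seg_family {1..n} s"
    unfolding JT_values_conv seg_family_def by blast
  have "y \<le> (C powr p) powr (1 / p)"
    unfolding y using assms(2)[OF s] p_gt_2 by (intro powr_mono2) (auto simp: family_sum_nonneg)
  then show "y \<le> C"
    using assms(1) p_gt_2 by (simp add: powr_powr)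
qed

lemma less_JT_norm:
  assumes "0 \<le> c" "c < JT_norm le p v"
  obtains n :: nat and s where "seg_family {1..n} s" "c powr p < family_sum v {1..n} s"
  using assms JT_norm_le[of c v] by (meson not_le)

lemma JT_norm_nonneg: "0 \<le> JT_norm le p v"
proof -
  obtain y where y: "y \<in> JT_values le p v"
    using JT_values_nonempty[OF tree] by blast
  then have "0 \<le> y"
    by (auto simp: JT_values_def)
  also have "y \<le> JT_norm le p v"
    unfolding JT_norm_def using y bdd_above_JT_values[OF tree] p_gt_2 by (intro cSup_upper) auto
  finally show ?thesis .
qed

text \<open>The finitely many support points on the chain lie in a single segment, and a family
  consisting of this segment alone is admissible.\<close>

lemma sq_mass_chain_le_JT_norm:
  assumes "chain_set T"
  shows "sqrt (sq_mass v T) \<le> JT_norm le p v"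
proof (cases "Poly_Mapping.keys v \<inter> T = {}")
  case True
  then show ?thesis
    by (simp add: sq_mass_def JT_norm_nonneg)
next
  case False
  then obtain s where s: "segment le s" "Poly_Mapping.keys v \<inter> T \<subseteq> s"
    using chain_subset_segment[OF assms, of "Poly_Mapping.keys v \<inter> T"] by auto
  then have "sq_mass v T \<le> sq_mass v s"
    by (intro sq_mass_mono)
  then have "sq_mass v T powr (p / 2) \<le> sq_mass v s powr (p / 2)"
    using p_gt_2 by (intro powr_mono2) auto
  also have "\<dots> = family_sum v {()} (\<lambda>_. s)"
    by (simp add: family_sum_def)
  also have "\<dots> \<le> JT_norm le p v powr p"
    by (rule family_sum_le_JT_norm) (simp add: seg_family_def s disjoint_family_on_def)
  finally have "(sq_mass v T powr (p / 2)) powr (1 / p) \<le> (JT_norm le p v powr p) powr (1 / p)"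
    using p_gt_2 by (intro powr_mono2) auto
  then show ?thesis
    using p_gt_2 by (simp add: powr_powr JT_norm_nonneg powr_half_sqrt)
qed

lemma abs_lookup_le_JT_norm: "\<bar>Poly_Mapping.lookup v i\<bar> \<le> JT_norm le p v"
proof -
  have "sqrt (sq_mass v {i}) = \<bar>Poly_Mapping.lookup v i\<bar>"
    by (simp flip: sq_mass_finite)
  moreover have "chain_set {i}"
    by (simp add: chain_set_def le_refl)
  ultimately show ?thesis
    using sq_mass_chain_le_JT_norm by metis
qed

end

section \<open>Estimates for block sequences\<close>

text \<open>Jensen's inequality for the convex function \<open>\<lambda>y. y powr q\<close> with
  weights \<open>c n / t\<close>.\<close>

lemma sum_powr_le_weighted:
  fixes c y :: "'i \<Rightarrow> real"
  assumes fin: "finite F" and c: "\<And>n. n \<in> F \<Longrightarrow> 0 \<le> c n" and y: "\<And>n. n \<in> F \<Longrightarrow> 0 \<le> y n" and q: "1 \<le> q"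
  shows "(\<Sum>n\<in>F. c n * y n) powr q \<le> (\<Sum>n\<in>F. c n) powr (q - 1) * (\<Sum>n\<in>F. c n * y n powr q)"
proof -
  \<comment> \<open>Dropping the vanishing terms leaves positive arguments and, unless
    \<open>S\<close> is empty, a positive total weight \<open>t\<close> to divide by.\<close>
  define S where "S = {n\<in>F. 0 < c n * y n}"
  have S: "finite S" "\<And>n. n \<in> S \<Longrightarrow> 0 < c n" "\<And>n. n \<in> S \<Longrightarrow> 0 < y n" "S \<subseteq> F"
    using fin c y by (auto simp: S_def zero_less_mult_iff dest: less_imp_le le_less_trans)
  have zero: "c n * y n = 0" if "n \<in> F - S" for n
    using that c[of n] y[of n] by (auto simp: S_def zero_less_mult_iff)
  have eq: "(\<Sum>n\<in>F. c n * y n) = (\<Sum>n\<in>S. c n * y n)"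
    using fin S(4) zero by (intro sum.mono_neutral_right) auto
  show ?thesis
  proof (cases "S = {}")
    case True
    then show ?thesis
      unfolding eq using c by (auto intro!: mult_nonneg_nonneg sum_nonneg)
  next
    case False
    define t where "t = (\<Sum>n\<in>S. c n)"
    have t: "t > 0"
      unfolding t_def using S False by (intro sum_pos) auto
    have "(\<Sum>n\<in>S. (c n / t) *\<^sub>R y n) powr q \<le> (\<Sum>n\<in>S. (c n / t) * y n powr q)"
    proof (intro convex_on_sum[OF _ _ powr_convex])
      show "(\<Sum>n\<in>S. c n / t) = 1"
        using t by (simp add: t_def flip: sum_divide_distrib)
      show "0 \<le> c n / t" if "n \<in> S" for n
        using S(2)[OF that] t by simp
    qed (use S False q in auto)
    then have "((\<Sum>n\<in>S. c n * y n) / t) powr q \<le> (\<Sum>n\<in>S. c n * y n powr q) / t"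
      by (simp add: sum_divide_distrib)
    then have "t powr q * ((\<Sum>n\<in>S. c n * y n) / t) powr q \<le> t powr q * ((\<Sum>n\<in>S. c n * y n powr q) / t)"
      by (intro mult_left_mono) auto
    moreover have "t powr q * ((\<Sum>n\<in>S. c n * y n) / t) powr q = (\<Sum>n\<in>S. c n * y n) powr q"
    proof -
      have "0 \<le> (\<Sum>n\<in>S. c n * y n)"
        using S(2,3) by (intro sum_nonneg) (simp add: less_imp_le)
      then show ?thesis
        using t by (simp add: powr_divide)
    qed
    moreover have "t powr q * (z / t) = t powr (q - 1) * z" for z
      using t by (simp add: powr_diff)
    ultimately have "(\<Sum>n\<in>S. c n * y n) powr q \<le> t powr (q - 1) * (\<Sum>n\<in>S. c n * y n powr q)"
      by simp
    also have "\<dots> \<le> (\<Sum>n\<in>F. c n) powr (q - 1) * (\<Sum>n\<in>F. c n * y n powr q)"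
    proof (intro mult_mono powr_mono2)
      show "t \<le> (\<Sum>n\<in>F. c n)"
        unfolding t_def using fin S(4) c by (intro sum_mono2) auto
      show "(\<Sum>n\<in>S. c n * y n powr q) \<le> (\<Sum>n\<in>F. c n * y n powr q)"
        using fin S(4) c by (intro sum_mono2) auto
      show "0 \<le> (\<Sum>n\<in>S. c n * y n powr q)"
        using S(2) by (intro sum_nonneg) (simp add: less_imp_le)
    qed (use t q in auto)
    finally show ?thesis
      by (simp add: eq)
  qed
qed

text \<open>Induction from the least index \<open>b\<close>. Either \<open>B b\<close> is below
  \<open>\<eta> (b - 1)\<close> and is charged to it, or \<open>\<theta>\<close> pays for
  \<open>B b\<close> and separation lowers the threshold for all later indices to
  \<open>\<eta> (b - 1)\<close>. The halving of \<open>\<eta>\<close> keeps the total charge within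
  \<open>2 * \<eta> k\<close>.\<close>

lemma sum_le_of_separated:
  fixes B \<eta> :: "nat \<Rightarrow> real"
  assumes \<eta>: "\<And>n. 0 \<le> \<eta> n" "\<And>n. 2 * \<eta> (Suc n) \<le> \<eta> n"
    and sep: "\<And>k l n. k < l \<Longrightarrow> l < n \<Longrightarrow> min (B l) (B n) \<le> \<eta> k"
    and R: "finite R" "\<And>n. n \<in> R \<Longrightarrow> k < n" "\<And>n. n \<in> R \<Longrightarrow> B n \<le> \<theta>" "0 \<le> \<theta>"
  shows "(\<Sum>n\<in>R. B n) \<le> \<theta> + 2 * \<eta> k"
  using R
proof (induction R arbitrary: k \<theta> rule: finite_linorder_min_induct)
  case empty
  then show ?case
    using \<eta>(1)[of k] by simp
next
  case (insert b A)
  \<comment> \<open>Separation is used at the index just below \<open>b\<close>, so that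
    \<open>2 * \<eta> b \<le> \<eta> j\<close> absorbs the bound for the remaining indices.\<close>
  define j where "j = b - 1"
  have j: "b = Suc j" "k \<le> j"
    using insert.prems(1)[of b] by (auto simp: j_def)
  have "decseq \<eta>"
    using \<eta> by (intro decseq_SucI) (smt (verit))
  then have mono: "\<eta> j \<le> \<eta> k"
    using j(2) by (auto simp: decseq_def)
  have sum: "(\<Sum>n\<in>insert b A. B n) = B b + (\<Sum>n\<in>A. B n)"
    using insert.hyps by (subst sum.insert) auto
  show ?case
  proof (cases "B b \<le> \<eta> j")
    case True
    have "(\<Sum>n\<in>A. B n) \<le> \<theta> + 2 * \<eta> b"
      using insert.hyps insert.prems by (intro insert.IH) auto
    then show ?thesis
      using True sum mono \<eta>(2)[of j] j(1) by simp
  next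
    case False
    have "B n \<le> \<eta> j" if "n \<in> A" for n
      using sep[of j b n] False insert.hyps that j(1) by (auto simp: min_def split: if_splits)
    then have "(\<Sum>n\<in>A. B n) \<le> \<eta> j + 2 * \<eta> b"
      using insert.hyps insert.prems \<eta>(1) by (intro insert.IH) auto
    then show ?thesis
      using insert.prems(2)[of b] sum mono \<eta>(2)[of j] j(1) by simp
  qed
qed

text \<open>\<open>F\<close> splits into the index \<open>k\<close>, the later heavy indices (at
  most one, by separation) and the light ones. The first two parts are each bounded by the sum of
  powers, hence the factor 2; \<open>3 powr q\<close> comes from bounding a sum of three numbers by
  three times their maximum.\<close>

lemma sum_powr_le_of_separated:
  fixes B c \<eta> :: "nat \<Rightarrow> real"
  assumes \<eta>: "\<And>n. 0 \<le> \<eta> n" "\<And>n. 2 * \<eta> (Suc n) \<le> \<eta> n"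
    and B: "\<And>n. 0 \<le> B n" "\<And>n. n < k \<Longrightarrow> B n = 0"
    and sep: "\<And>k l n. k < l \<Longrightarrow> l < n \<Longrightarrow> min (B l) (B n) \<le> \<eta> k"
    and F: "finite F" "\<And>n. n \<in> F \<Longrightarrow> 0 \<le> c n" "\<And>n. n \<in> F \<Longrightarrow> c n \<le> M" and M: "0 \<le> M" and q: "1 \<le> q"
  shows "(\<Sum>n\<in>F. c n * B n) powr q
    \<le> 3 powr q * (2 * (\<Sum>n\<in>F. (c n * B n) powr q) + (M * (3 * \<eta> k)) powr q)"
proof -
  define X where "X = F \<inter> {k}"
  define Y where "Y = {n\<in>F. k < n \<and> \<eta> k < B n}"
  define Z where "Z = {n\<in>F. k < n \<and> B n \<le> \<eta> k}"
  define S where "S G = (\<Sum>n\<in>G. c n * B n)" for G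
  define P where "P = (\<Sum>n\<in>F. (c n * B n) powr q)"
  have S0: "0 \<le> S G" if "G \<subseteq> F" for G
    unfolding S_def using that F(2) B(1) by (intro sum_nonneg) auto
  have single: "S G powr q \<le> P" if "G \<subseteq> F" "\<And>m n. m \<in> G \<Longrightarrow> n \<in> G \<Longrightarrow> \<not> m < n" for G
  proof (cases "G = {}")
    case True
    then show ?thesis
      by (simp add: S_def P_def sum_nonneg)
  next
    case False
    then obtain n where n: "n \<in> G"
      by blast
    have "m = n" if "m \<in> G" for m
      using \<open>\<And>m n. m \<in> G \<Longrightarrow> n \<in> G \<Longrightarrow> \<not> m < n\<close>[OF that n]
        \<open>\<And>m n. m \<in> G \<Longrightarrow> n \<in> G \<Longrightarrow> \<not> m < n\<close>[OF n that] by simp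
    with n have "G = {n}"
      by blast
    then have "S G powr q = (c n * B n) powr q"
      by (simp add: S_def)
    also have "\<dots> \<le> P"
      unfolding P_def using n that(1) F(1)
      by (intro member_le_sum[where f = "\<lambda>n. (c n * B n) powr q"]) auto
    finally show ?thesis .
  qed
  have "S X powr q \<le> P"
    by (rule single) (auto simp: X_def)
  moreover have "S Y powr q \<le> P"
  proof (rule single)
    fix m n assume "m \<in> Y" "n \<in> Y"
    then show "\<not> m < n"
      using sep[of k m n] by (auto simp: Y_def)
  qed (auto simp: Y_def)
  moreover have "S Z powr q \<le> (M * (3 * \<eta> k)) powr q"
  proof (intro powr_mono2)
    have "S Z \<le> (\<Sum>n\<in>Z. M * B n)"
      unfolding S_def using F B(1) by (intro sum_mono mult_right_mono) (auto simp: Z_def)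
    also have "\<dots> = M * (\<Sum>n\<in>Z. B n)"
      by (simp add: sum_distrib_left)
    \<comment> \<open>All light terms lie below \<open>\<theta> = \<eta> k\<close>, which gives the
      constant 3.\<close>
    also have "\<dots> \<le> M * (\<eta> k + 2 * \<eta> k)"
      using F(1) \<eta> sep M by (intro mult_left_mono sum_le_of_separated) (auto simp: Z_def)
    finally show "S Z \<le> M * (3 * \<eta> k)"
      by simp
  qed (use q S0[of Z] in \<open>auto simp: Z_def\<close>)
  moreover have "S F powr q \<le> 3 powr q * (S X powr q + S Y powr q + S Z powr q)"
  proof -
    define m where "m = max (S X) (max (S Y) (S Z))"
    have sub: "0 \<le> S X" "0 \<le> S Y" "0 \<le> S Z"
      by (auto intro!: S0 simp: X_def Y_def Z_def)
    have "S F = S (X \<union> (Y \<union> Z))"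
      unfolding S_def using F(1) B(2)
      by (intro sum.mono_neutral_right) (auto simp: X_def Y_def Z_def not_less not_le linorder_neq_iff)
    also have "\<dots> = S X + (S Y + S Z)"
      unfolding S_def using F(1) by (subst sum.union_disjoint; (subst sum.union_disjoint)?) (auto simp: X_def Y_def Z_def)
    also have "\<dots> \<le> 3 * m"
      by (simp add: m_def)
    finally have "S F powr q \<le> (3 * m) powr q"
      using q S0 by (intro powr_mono2) auto
    also have "\<dots> = 3 powr q * m powr q"
      by (rule powr_mult)
    also have "m powr q \<le> S X powr q + S Y powr q + S Z powr q"
      by (auto simp: m_def max_def)
    finally show ?thesis
      by simp
  qed
  ultimately show ?thesis
    unfolding S_def[symmetric] P_def[symmetric]
    by (smt (verit) mult_left_mono powr_ge_zero)
qed

lemma lq_norm_2: "lq_norm 2 a = sqrt (\<Sum>n\<in>Poly_Mapping.keys a. (Poly_Mapping.lookup a n)\<^sup>2)"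
  by (simp add: lq_norm_def powr_half_sqrt sum_nonneg)

context James_tree
begin

lemma powr_half: "0 \<le> x \<Longrightarrow> (x\<^sup>2) powr (p / 2) = x powr p"
  by (simp add: powr_powr flip: powr_numeral)

text \<open>Each block has a family on which its mass exceeds \<open>c powr p\<close>. Cut down to
  the intervals of the blocks, these families are jointly disjoint and form one admissible family
  for the combination.\<close>

lemma lower_lp_estimate:
  assumes block: "block_seq lo hi u" and c: "0 \<le> c" "\<And>n. c < JT_norm le p (u n)"
  shows "c * lq_norm p a \<le> JT_norm le p (lin_comb a u)"
proof -
  let ?K = "Poly_Mapping.keys a"
  have "\<exists>m::nat. \<exists>s. seg_family {1..m} s \<and> c powr p < family_sum (u n) {1..m} s" for n
    using less_JT_norm[OF c(1) c(2)[of n]] by metis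
  then obtain m :: "nat \<Rightarrow> nat" and s where
    s: "\<And>n. seg_family {1..m n} (s n)" "\<And>n. c powr p < family_sum (u n) {1..m n} (s n)"
    by metis
  define I where "I = Sigma ?K (\<lambda>n. {1..m n})"
  define S where "S = (\<lambda>(n, k). s n k \<inter> {lo n..<hi n})"
  have S: "seg_family I S"
    unfolding seg_family_def
  proof (intro conjI ballI)
    show "finite I"
      by (auto simp: I_def)
    fix x assume "x \<in> I"
    then show "segment le (S x) \<or> S x = {}"
      using s(1) segment_Int_interval unfolding I_def S_def seg_family_def by fastforce
  next
    show "disjoint_family_on S I"
      unfolding disjoint_family_on_def
    proof (intro ballI impI)
      fix x y assume "x \<in> I" "y \<in> I" "x \<noteq> y"
      obtain n k n' k' where xy: "x = (n, k)" "y = (n', k')"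
        by (cases x, cases y)
      show "S x \<inter> S y = {}"
      proof (cases "n = n'")
        case True
        then have "k \<in> {1..m n}" "k' \<in> {1..m n}" "k \<noteq> k'"
          using \<open>x \<in> I\<close> \<open>y \<in> I\<close> \<open>x \<noteq> y\<close> unfolding xy I_def by auto
        then have "s n k \<inter> s n k' = {}"
          using s(1)[of n] unfolding seg_family_def disjoint_family_on_def by blast
        then show ?thesis
          using True unfolding xy S_def by auto
      next
        case False
        then show ?thesis
          using block_seq_inj[OF block, of _ n n'] unfolding xy S_def by blast
      qed
    qed
  qed
  have "c powr p * lq_norm p a powr p = (\<Sum>n\<in>?K. \<bar>Poly_Mapping.lookup a n\<bar> powr p * c powr p)"
    using p_gt_2 by (simp add: lq_norm_powr sum_distrib_left mult.commute)
  also have "\<dots> \<le> (\<Sum>n\<in>?K. \<bar>Poly_Mapping.lookup a n\<bar> powr p * family_sum (u n) {1..m n} (s n))"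
    using s(2) by (intro sum_mono mult_left_mono) (auto intro: less_imp_le)
  also have "\<dots> = (\<Sum>n\<in>?K. \<Sum>k\<in>{1..m n}. ((Poly_Mapping.lookup a n)\<^sup>2 * sq_mass (u n) (S (n, k))) powr (p / 2))"
  proof (intro sum.cong refl)
    fix n
    \<comment> \<open>The interval contains the support of \<open>u n\<close>, so cutting loses no
      mass.\<close>
    have "sq_mass (u n) (s n k) = sq_mass (u n) (S (n, k))" for k
      using block_seqD(1)[OF block, of n] by (intro antisym sq_mass_mono) (auto simp: S_def)
    then show "\<bar>Poly_Mapping.lookup a n\<bar> powr p * family_sum (u n) {1..m n} (s n) =
        (\<Sum>k\<in>{1..m n}. ((Poly_Mapping.lookup a n)\<^sup>2 * sq_mass (u n) (S (n, k))) powr (p / 2))"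
      using powr_half[of "\<bar>Poly_Mapping.lookup a n\<bar>"]
      by (simp add: family_sum_def sum_distrib_left powr_mult)
  qed
  also have "\<dots> \<le> (\<Sum>n\<in>?K. \<Sum>k\<in>{1..m n}. sq_mass (lin_comb a u) (S (n, k)) powr (p / 2))"
  proof (intro sum_mono powr_mono2)
    fix n k assume n: "n \<in> ?K"
    show "(Poly_Mapping.lookup a n)\<^sup>2 * sq_mass (u n) (S (n, k)) \<le> sq_mass (lin_comb a u) (S (n, k))"
      unfolding sq_mass_lin_comb[OF block]
      by (rule member_le_sum[OF n]) auto
  qed (use p_gt_2 in auto)
  also have "\<dots> = family_sum (lin_comb a u) I S"
    unfolding family_sum_def I_def by (subst sum.Sigma) auto
  also have "\<dots> \<le> JT_norm le p (lin_comb a u) powr p"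
    by (rule family_sum_le_JT_norm[OF S])
  finally have "(c * lq_norm p a) powr p \<le> JT_norm le p (lin_comb a u) powr p"
    using c(1) by (simp add: powr_mult lq_norm_nonneg)
  then show ?thesis
    using powr_less_mono2[of p "JT_norm le p (lin_comb a u)" "c * lq_norm p a"] p_gt_2 JT_norm_nonneg
    by (meson less_trans not_le zero_less_numeral)
qed

lemma family_sum_le_powr:
  assumes "seg_family I s" "JT_norm le p v \<le> C"
  shows "family_sum v I s \<le> C powr p"
proof -
  have "JT_norm le p v powr p \<le> C powr p"
    using assms(2) p_gt_2 JT_norm_nonneg by (intro powr_mono2) auto
  then show ?thesis
    using family_sum_le_JT_norm[OF assms(1), of v] by linarith
qed

text \<open>Jensen's inequality with the squared coefficients as weights bounds the mass on each
  segment. After the two sums are interchanged, the family is tested on every block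
  separately.\<close>

lemma upper_l2_estimate:
  assumes block: "block_seq lo hi u" and C: "\<And>n. JT_norm le p (u n) \<le> C"
  shows "JT_norm le p (lin_comb a u) \<le> C * lq_norm 2 a"
proof (rule JT_norm_le)
  let ?K = "Poly_Mapping.keys a"
  define A where "A = (\<Sum>n\<in>?K. (Poly_Mapping.lookup a n)\<^sup>2)"
  have A: "0 \<le> A"
    by (simp add: A_def sum_nonneg)
  have C0: "0 \<le> C"
    using C[of 0] JT_norm_nonneg[of "u 0"] by linarith
  then show "0 \<le> C * lq_norm 2 a"
    by (simp add: lq_norm_nonneg)
  fix M :: nat and s assume s: "seg_family {1..M} s"
  have "family_sum (lin_comb a u) {1..M} s \<le>
      (\<Sum>k=1..M. A powr (p / 2 - 1) * (\<Sum>n\<in>?K. (Poly_Mapping.lookup a n)\<^sup>2 * sq_mass (u n) (s k) powr (p / 2)))"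
    unfolding family_sum_def sq_mass_lin_comb[OF block] A_def using p_gt_2
    by (intro sum_mono sum_powr_le_weighted) auto
  also have "\<dots> = A powr (p / 2 - 1) * (\<Sum>n\<in>?K. (Poly_Mapping.lookup a n)\<^sup>2 * family_sum (u n) {1..M} s)"
    unfolding family_sum_def sum_distrib_left by (subst sum.swap) (simp add: sum_distrib_left)
  also have "\<dots> \<le> A powr (p / 2 - 1) * (\<Sum>n\<in>?K. (Poly_Mapping.lookup a n)\<^sup>2 * C powr p)"
    using family_sum_le_powr[OF s C] by (intro mult_left_mono sum_mono) auto
  also have "\<dots> = A powr (p / 2) * C powr p"
    using A by (simp add: A_def[symmetric] powr_diff flip: sum_distrib_right)
  also have "\<dots> = (C * lq_norm 2 a) powr p"
    using C0 A by (simp add: lq_norm_2 powr_mult powr_powr flip: A_def powr_half_sqrt)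
  finally show "family_sum (lin_comb a u) {1..M} s \<le> (C * lq_norm 2 a) powr p" .
qed

lemma lower_l2_estimate:
  assumes block: "block_seq lo hi u" and T: "chain_set T"
    and d: "0 \<le> d" "\<And>n. d \<le> sq_mass (u n) T"
  shows "sqrt d * lq_norm 2 a \<le> JT_norm le p (lin_comb a u)"
proof -
  have "d * (\<Sum>n\<in>Poly_Mapping.keys a. (Poly_Mapping.lookup a n)\<^sup>2) \<le> sq_mass (lin_comb a u) T"
    unfolding sq_mass_lin_comb[OF block] sum_distrib_left mult.commute[of d]
    using d by (intro sum_mono mult_left_mono) auto
  then have "sqrt d * lq_norm 2 a \<le> sqrt (sq_mass (lin_comb a u) T)"
    unfolding lq_norm_2 real_sqrt_mult[symmetric] by (rule real_sqrt_le_mono)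
  also have "\<dots> \<le> JT_norm le p (lin_comb a u)"
    by (rule sq_mass_chain_le_JT_norm[OF T])
  finally show ?thesis .
qed

text \<open>The threshold decays with \<open>hi k\<close>, not merely with \<open>k\<close>: a
  segment whose first block is the \<open>k\<close>-th contains a point below \<open>hi k\<close>,
  and such points differ for disjoint segments.\<close>

lemma upper_lp_estimate:
  assumes block: "block_seq lo hi u" and C: "\<And>n. JT_norm le p (u n) \<le> C"
    and sep: "\<And>k l n s. k < l \<Longrightarrow> l < n \<Longrightarrow> segment le s \<Longrightarrow>
      min (sq_mass (u l) s) (sq_mass (u n) s) \<le> (1/2) ^ hi k"
  shows "\<exists>D>0. \<forall>a. JT_norm le p (lin_comb a u) \<le> D * lq_norm p a"
proof (intro exI conjI allI)
  \<comment> \<open>\<open>3 powr (p / 2)\<close> is the cost of the splitting into three parts,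
    \<open>2 * C powr p\<close> pays for the first and the heavy block, and
    \<open>2 * 3 powr (p / 2)\<close> is the light error times the sum 2 of the geometric
    series.\<close>
  define E where "E = 3 powr (p / 2) * (2 * C powr p + 2 * 3 powr (p / 2))"
  have E: "E > 0"
    unfolding E_def by (intro mult_pos_pos add_nonneg_pos) auto
  then show D: "E powr (1 / p) > 0"
    by simp
  fix a :: "nat \<Rightarrow>\<^sub>0 real"
  let ?K = "Poly_Mapping.keys a"
  define N where "N = lq_norm p a"
  define \<eta> :: "nat \<Rightarrow> real" where "\<eta> n = (1/2) ^ hi n" for n
  have N: "0 \<le> N"
    by (simp add: N_def lq_norm_nonneg)
  show "JT_norm le p (lin_comb a u) \<le> E powr (1 / p) * lq_norm p a"
  proof (rule JT_norm_le)
    show "0 \<le> E powr (1 / p) * lq_norm p a"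
      by (simp add: lq_norm_nonneg)
    fix n :: nat and s assume s: "seg_family {1..n} s"
    define I where "I = {k\<in>{1..n}. \<exists>m. sq_mass (u m) (s k) \<noteq> 0}"
    define \<kappa> where "\<kappa> k = (LEAST m. sq_mass (u m) (s k) \<noteq> 0)" for k
    have \<kappa>: "sq_mass (u (\<kappa> k)) (s k) \<noteq> 0" if "k \<in> I" for k
    proof -
      obtain m where "sq_mass (u m) (s k) \<noteq> 0"
        using \<open>k \<in> I\<close> unfolding I_def by blast
      then show ?thesis
        unfolding \<kappa>_def by (rule LeastI[where P = "\<lambda>m. sq_mass (u m) (s k) \<noteq> 0"])
    qed
    have below: "sq_mass (u m) (s k) = 0" if "m < \<kappa> k" for m k
      using not_less_Least that unfolding \<kappa>_def by blast
    have "\<exists>i. i \<in> Poly_Mapping.keys (u (\<kappa> k)) \<inter> s k" if "k \<in> I" for k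
      using \<kappa>[OF that] by (elim sq_mass_pos_imp) blast
    then obtain \<iota> where \<iota>: "\<And>k. k \<in> I \<Longrightarrow> \<iota> k \<in> Poly_Mapping.keys (u (\<kappa> k)) \<inter> s k"
      by metis
    have fam: "seg_family I s"
      using s by (auto simp: I_def seg_family_def disjoint_family_on_def)
    \<comment> \<open>Distinct segments have distinct \<open>\<iota> k\<close>, so the errors \<open>\<eta> (\<kappa> k)\<close> are summed by a geometric series.\<close>
    have inj: "inj_on \<iota> I"
    proof (rule inj_onI, rule ccontr)
      fix k l assume "k \<in> I" "l \<in> I" "\<iota> k = \<iota> l" "k \<noteq> l"
      then show False
        using fam \<iota>[of k] \<iota>[of l] unfolding seg_family_def disjoint_family_on_def by auto
    qed
    have finI: "finite I"
      by (simp add: I_def)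
    have \<eta>: "0 \<le> \<eta> m" "2 * \<eta> (Suc m) \<le> \<eta> m" "\<eta> m \<le> 1" for m
    proof -
      have "Suc (hi m) \<le> hi (Suc m)"
        using strict_monoD[OF block_seq_hi_strict_mono[OF block], of m "Suc m"] by simp
      then have "(1/2::real) ^ hi (Suc m) \<le> (1/2) ^ Suc (hi m)"
        by (intro power_decreasing) auto
      then show "2 * \<eta> (Suc m) \<le> \<eta> m"
        by (simp add: \<eta>_def)
    qed (auto simp: \<eta>_def power_le_one)
    have \<eta>_\<iota>: "\<eta> (\<kappa> k) \<le> (1/2) ^ \<iota> k" if "k \<in> I" for k
      unfolding \<eta>_def using \<iota>[OF that] block_seqD(1)[OF block, of "\<kappa> k"]
      by (intro power_decreasing) auto
    have each: "sq_mass (lin_comb a u) (s k) powr (p / 2) \<le>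
        3 powr (p / 2) * (2 * (\<Sum>m\<in>?K. \<bar>Poly_Mapping.lookup a m\<bar> powr p * sq_mass (u m) (s k) powr (p / 2))
          + N powr p * 3 powr (p / 2) * (1/2) ^ \<iota> k)" (is "_ \<le> ?rhs") if k: "k \<in> I" for k
    proof -
      have seg: "segment le (s k)"
        using fam k \<kappa>[OF k] by (auto simp: seg_family_def)
      have "sq_mass (lin_comb a u) (s k) powr (p / 2) \<le>
        3 powr (p / 2) * (2 * (\<Sum>m\<in>?K. ((Poly_Mapping.lookup a m)\<^sup>2 * sq_mass (u m) (s k)) powr (p / 2))
          + (N\<^sup>2 * (3 * \<eta> (\<kappa> k))) powr (p / 2))"
        unfolding sq_mass_lin_comb[OF block]
      \<comment> \<open>Here \<open>\<kappa> k\<close>, the first block with mass on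
        \<open>s k\<close>, is the starting index, and the weights are the squared coefficients,
        bounded by \<open>N\<^sup>2\<close>.\<close>
      proof (rule sum_powr_le_of_separated[where \<eta> = \<eta>])
        show "min (sq_mass (u l) (s k)) (sq_mass (u n) (s k)) \<le> \<eta> j" if "j < l" "l < n" for j l n
          unfolding \<eta>_def by (rule sep[OF that seg])
        show "(Poly_Mapping.lookup a m)\<^sup>2 \<le> N\<^sup>2" if "m \<in> ?K" for m
        proof -
          have "\<bar>Poly_Mapping.lookup a m\<bar> \<le> N"
            unfolding N_def using that p_gt_2 by (intro abs_lookup_le_lq_norm) auto
          then show ?thesis
            using abs_le_square_iff[of "Poly_Mapping.lookup a m" N] N by simp
        qed
      qed (use \<eta> below p_gt_2 in auto)
      also have "(\<Sum>m\<in>?K. ((Poly_Mapping.lookup a m)\<^sup>2 * sq_mass (u m) (s k)) powr (p / 2)) =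
          (\<Sum>m\<in>?K. \<bar>Poly_Mapping.lookup a m\<bar> powr p * sq_mass (u m) (s k) powr (p / 2))"
        using powr_half[of "\<bar>_\<bar>"] by (simp add: powr_mult)
      also have "(N\<^sup>2 * (3 * \<eta> (\<kappa> k))) powr (p / 2) \<le> N powr p * 3 powr (p / 2) * (1/2) ^ \<iota> k"
      proof -
        \<comment> \<open>Since \<open>\<eta>\<close> is at most 1 and \<open>p / 2\<close> exceeds
          1, the power only makes the error smaller.\<close>
        have "\<eta> (\<kappa> k) powr (p / 2) \<le> \<eta> (\<kappa> k) powr 1"
          using \<eta>[of "\<kappa> k"] p_gt_2 by (intro powr_mono') auto
        then have "\<eta> (\<kappa> k) powr (p / 2) \<le> (1/2) ^ \<iota> k"
          using \<eta>(1)[of "\<kappa> k"] \<eta>_\<iota>[OF k] by simp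
        then show ?thesis
          using \<eta>(1)[of "\<kappa> k"] N by (simp add: powr_mult powr_half mult.assoc mult_left_mono)
      qed
      finally show ?thesis
        by simp
    qed
    have "family_sum (lin_comb a u) {1..n} s = family_sum (lin_comb a u) I s"
      unfolding family_sum_def
      by (intro sum.mono_neutral_right) (auto simp: I_def sq_mass_lin_comb[OF block])
    also have "\<dots> \<le> (\<Sum>k\<in>I. 3 powr (p / 2) * (2 * (\<Sum>m\<in>?K. \<bar>Poly_Mapping.lookup a m\<bar> powr p * sq_mass (u m) (s k) powr (p / 2))
          + N powr p * 3 powr (p / 2) * (1/2) ^ \<iota> k))"
      unfolding family_sum_def by (intro sum_mono each)
    also have "\<dots> = 3 powr (p / 2) * (2 * (\<Sum>m\<in>?K. \<bar>Poly_Mapping.lookup a m\<bar> powr p * family_sum (u m) I s)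
        + N powr p * 3 powr (p / 2) * (\<Sum>k\<in>I. (1/2) ^ \<iota> k))"
    proof -
      have "(\<Sum>k\<in>I. \<Sum>m\<in>?K. \<bar>Poly_Mapping.lookup a m\<bar> powr p * sq_mass (u m) (s k) powr (p / 2)) =
          (\<Sum>m\<in>?K. \<bar>Poly_Mapping.lookup a m\<bar> powr p * family_sum (u m) I s)"
        unfolding family_sum_def sum_distrib_left by (rule sum.swap)
      then show ?thesis
        by (simp add: sum.distrib flip: sum_distrib_left)
    qed
    also have "\<dots> \<le> 3 powr (p / 2) * (2 * (N powr p * C powr p) + N powr p * 3 powr (p / 2) * 2)"
    proof (intro mult_left_mono add_mono)
      have "(\<Sum>m\<in>?K. \<bar>Poly_Mapping.lookup a m\<bar> powr p * family_sum (u m) I s) \<le>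
          (\<Sum>m\<in>?K. \<bar>Poly_Mapping.lookup a m\<bar> powr p * C powr p)"
        by (intro sum_mono mult_left_mono family_sum_le_powr[OF fam C]) auto
      also have "\<dots> = N powr p * C powr p"
        using p_gt_2 by (simp add: N_def lq_norm_powr sum_distrib_right)
      finally show "(\<Sum>m\<in>?K. \<bar>Poly_Mapping.lookup a m\<bar> powr p * family_sum (u m) I s) \<le> N powr p * C powr p" .
      have "(\<Sum>k\<in>I. (1/2::real) ^ \<iota> k) = (\<Sum>i\<in>\<iota> ` I. (1/2) ^ i)"
        by (simp add: sum.reindex[OF inj])
      also have "\<dots> \<le> suminf (\<lambda>i. (1/2) ^ i)"
        using finI by (intro sum_le_suminf) (auto intro: summable_geometric)
      also have "\<dots> = 2"
        by (subst suminf_geometric) auto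
      finally show "(\<Sum>k\<in>I. (1/2::real) ^ \<iota> k) \<le> 2" .
    qed auto
    also have "\<dots> = (E powr (1 / p) * lq_norm p a) powr p"
      using E N p_gt_2 by (simp add: E_def N_def powr_mult powr_powr algebra_simps)
    finally show "family_sum (lin_comb a u) {1..n} s \<le> (E powr (1 / p) * lq_norm p a) powr p" .
  qed
qed

end

text \<open>By \<open>m + n \<le> r n\<close> the sum is dominated by a geometric tail. A late start
  \<open>m\<close> makes the perturbation as small as desired.\<close>

lemma sum_geometric_subseq_le:
  fixes r :: "nat \<Rightarrow> nat"
  assumes "strict_mono r" "m \<le> r 0" "finite F"
  shows "(\<Sum>n\<in>F. (1/2::real) ^ r n) \<le> 2 * (1/2) ^ m"
proof -
  have "m + n \<le> r n" for n
  proof (induction n)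
    case (Suc n)
    then show ?case
      using strict_monoD[OF assms(1), of n "Suc n"] by simp
  qed (use assms in simp)
  then have "(\<Sum>n\<in>F. (1/2::real) ^ r n) \<le> (\<Sum>n\<in>F. (1/2) ^ m * (1/2) ^ n)"
    by (intro sum_mono) (simp add: power_decreasing flip: power_add)
  also have "\<dots> \<le> (1/2) ^ m * suminf (\<lambda>n. (1/2) ^ n)"
    unfolding sum_distrib_left[symmetric] using assms(3)
    by (intro mult_left_mono sum_le_suminf) (auto intro: summable_geometric)
  also have "\<dots> = 2 * (1/2) ^ m"
    by (subst suminf_geometric) auto
  finally show ?thesis .
qed

text \<open>Gives the entry sets of all blocks a common index range, so that limits can be taken for
  each index. Surplus values of \<open>e\<close> do no harm.\<close>

lemma finite_card_le_covered:
  assumes "finite E" "card E \<le> K"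
  shows "\<exists>e. E \<subseteq> e ` {..<K::nat}"
proof -
  obtain h where "bij_betw h {0..<card E} E"
    using ex_bij_betw_nat_finite[OF assms(1)] by blast
  then have "E = h ` {0..<card E}"
    by (simp add: bij_betw_def)
  also have "\<dots> \<subseteq> h ` {..<K}"
    using assms(2) by (intro image_mono) auto
  finally show ?thesis
    by blast
qed

section \<open>Separated subsequences\<close>

context James_tree
begin

text \<open>The nodes at which a chain can enter \<open>{m..}\<close> and then collect square mass at least \<open>\<epsilon>\<close>.\<close>

definition heavy_entries :: "(nat \<Rightarrow>\<^sub>0 real) \<Rightarrow> nat \<Rightarrow> real \<Rightarrow> nat set" where
  "heavy_entries v m \<epsilon> = {t\<in>{m..}. (\<forall>k. le k t \<and> m \<le> k \<longrightarrow> k = t) \<and>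
     (\<exists>M. le t M \<and> \<epsilon> \<le> sq_mass v {k. le t k \<and> le k M})}"

text \<open>Segments starting at distinct entries are disjoint, so the norm bounds their number.\<close>

lemma card_heavy_entries_le:
  assumes \<epsilon>: "\<epsilon> > 0" and C: "JT_norm le p v \<le> C"
  shows "finite (heavy_entries v m \<epsilon>) \<and> real (card (heavy_entries v m \<epsilon>)) \<le> C powr p / \<epsilon> powr (p / 2)"
proof -
  have bound: "real (card E) \<le> C powr p / \<epsilon> powr (p / 2)" if E: "finite E" "E \<subseteq> heavy_entries v m \<epsilon>" for E
  proof -
    have "\<forall>t\<in>E. \<exists>M. le t M \<and> \<epsilon> \<le> sq_mass v {k. le t k \<and> le k M}"
      using E by (auto simp: heavy_entries_def)
    then obtain M where M: "\<And>t. t \<in> E \<Longrightarrow> le t (M t)"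
      "\<And>t. t \<in> E \<Longrightarrow> \<epsilon> \<le> sq_mass v {k. le t k \<and> le k (M t)}"
      by metis
    define s where "s t = {k. le t k \<and> le k (M t)}" for t
    have "t = t'" if "t \<in> E" "t' \<in> E" "k \<in> s t" "k \<in> s t'" for t t' k
    proof -
      \<comment> \<open>Two predecessors of \<open>k\<close> are comparable, and two comparable
        entries coincide, since an entry has no other predecessor in \<open>{m..}\<close>.\<close>
      have "le t t' \<or> le t' t"
        using that pred_total[of t k t'] pred_total[of t' k t] linear[of t t'] unfolding s_def by blast
      then show ?thesis
        using that E by (auto simp: heavy_entries_def)
    qed
    then have "disjoint_family_on s E"
      unfolding disjoint_family_on_def by blast
    moreover have "\<forall>t\<in>E. segment le (s t)"
      unfolding segment_def s_def using M(1) by blast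
    ultimately have "family_sum v E s \<le> C powr p"
      using E C by (intro family_sum_le_powr) (auto simp: seg_family_def)
    moreover have "real (card E) * \<epsilon> powr (p / 2) \<le> family_sum v E s"
      unfolding family_sum_def using M(2) \<epsilon> p_gt_2
      by (intro sum_bounded_below powr_mono2) (auto simp: s_def)
    ultimately show ?thesis
      using \<epsilon> by (simp add: field_simps)
  qed
  have "finite (heavy_entries v m \<epsilon>)"
  proof (rule ccontr)
    assume "infinite (heavy_entries v m \<epsilon>)"
    then obtain E where "finite E" "E \<subseteq> heavy_entries v m \<epsilon>" "card E = Suc (nat \<lceil>C powr p / \<epsilon> powr (p / 2)\<rceil>)"
      using infinite_arbitrarily_large by blast
    then show False
      using bound[of E] by linarith
  qed
  then show ?thesis
    using bound by blast
qed

text \<open>The entry \<open>t\<close> is the first predecessor of the upper end \<open>b\<close> in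
  \<open>{m..}\<close>. It may precede the lower end of \<open>s\<close>; the segment from
  \<open>t\<close> to \<open>b\<close> still contains all support points of \<open>v\<close> in
  \<open>s\<close>.\<close>

lemma segment_through_heavy_entry:
  assumes s: "segment le s" and keys: "Poly_Mapping.keys v \<subseteq> {m..}"
    and \<epsilon>: "0 < \<epsilon>" "\<epsilon> \<le> sq_mass v s"
  obtains t where "t \<in> heavy_entries v m \<epsilon>" "\<And>k. k \<in> s \<Longrightarrow> k < m \<Longrightarrow> le k t"
proof -
  obtain a b where ab: "le a b" "s = {k. le a k \<and> le k b}"
    using s unfolding segment_def by blast
  define t where "t = (LEAST k. le k b \<and> m \<le> k)"
  obtain i where i: "i \<in> Poly_Mapping.keys v" "i \<in> s"
    using sq_mass_pos_imp[of v s] \<epsilon> by (metis less_le_trans less_irrefl)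
  then have "le i b \<and> m \<le> i"
    using keys ab by auto
  then have t: "le t b \<and> m \<le> t"
    unfolding t_def by (rule LeastI)
  have least: "t \<le> k" if "le k b" "m \<le> k" for k
    unfolding t_def using that by (intro Least_le) simp
  have "k = t" if "le k t" "m \<le> k" for k
    using least[of k] le_trans[of k t b] le_imp_le[of k t] t that by auto
  moreover have "sq_mass v s \<le> sq_mass v {k. le t k \<and> le k b}"
  proof (rule sq_mass_mono, rule subsetI)
    fix k assume k: "k \<in> Poly_Mapping.keys v \<inter> s"
    then have "le k b" "t \<le> k"
      using ab keys least[of k] by auto
    then show "k \<in> {k. le t k \<and> le k b}"
      using t pred_total[of t b k] by auto
  qed
  ultimately have "t \<in> heavy_entries v m \<epsilon>"
    unfolding heavy_entries_def using t \<epsilon>(2) order_trans by auto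
  moreover have "le k t" if "k \<in> s" "k < m" for k
    using pred_total[of k b t] that ab t by auto
  ultimately show ?thesis
    by (rule that)
qed

text \<open>The predecessor sets of the boundedly many heavy entries of the blocks have, along a
  subsequence, limits that are chains; later blocks are chosen to be light on these limits.\<close>

lemma separated_subseq:
  assumes block: "block_seq lo hi u" and C: "\<And>n. JT_norm le p (u n) \<le> C"
    and null: "\<And>T. chain_set T \<Longrightarrow> (\<lambda>n. sq_mass (u n) T) \<longlonglongrightarrow> 0"
  shows "\<exists>r::nat \<Rightarrow> nat. strict_mono r \<and> (\<forall>k l n s. k < l \<and> l < n \<and> segment le s \<longrightarrow>
    min (sq_mass (u (r l)) s) (sq_mass (u (r n)) s) \<le> (1/2) ^ hi (r k))"
proof -
  define E where "E m j = heavy_entries (u m) (lo m) ((1/2) ^ j)" for m j :: nat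
  \<comment> \<open>The bound on the number of entries depends on the threshold but not on the
    block.\<close>
  define K where "K j = nat \<lceil>C powr p / ((1/2) ^ j) powr (p / 2)\<rceil>" for j :: nat
  have "\<exists>e. E m j \<subseteq> e ` {..<K j}" for m j
  proof (rule finite_card_le_covered)
    show "finite (E m j)" "card (E m j) \<le> K j"
      using card_heavy_entries_le[OF _ C, of "(1/2) ^ j" m "lo m"]
      unfolding E_def K_def by (auto simp: le_nat_iff intro: of_nat_ceiling order_trans) linarith
  qed
  then obtain e where e: "\<And>m j. E m j \<subseteq> e m j ` {..<K j}"
    by metis
  define T where "T m = (\<lambda>(j, i). {k. le k (e m j i)})" for m
  obtain r0 and L where r0: "strict_mono r0"
    and L: "\<And>ji k. eventually (\<lambda>m. k \<in> T (r0 m) ji \<longleftrightarrow> k \<in> L ji) sequentially"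
    using pointwise_convergent_subseq_of_sets[of T] by blast
  have "chain_set (L ji)" for ji
    unfolding chain_set_def
  proof (intro ballI impI)
    fix k l assume "k \<in> L ji" "l \<in> L ji" "k \<le> l"
    moreover have "eventually (\<lambda>m. (k \<in> T (r0 m) ji \<longleftrightarrow> k \<in> L ji) \<and> (l \<in> T (r0 m) ji \<longleftrightarrow> l \<in> L ji)) sequentially"
      by (intro eventually_conj L)
    ultimately obtain m where "k \<in> T (r0 m) ji" "l \<in> T (r0 m) ji"
      by (auto simp: eventually_sequentially)
    moreover have "chain_set (T (r0 m) ji)"
      by (cases ji) (simp add: T_def chain_set_preds)
    ultimately show "le k l"
      using \<open>k \<le> l\<close> unfolding chain_set_def by blast
  qed
  then have light: "eventually (\<lambda>m. sq_mass (u (r0 m)) (L (j, i)) < (1/2) ^ j) sequentially" for j i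
    using LIMSEQ_subseq_LIMSEQ[OF null r0] by (intro order_tendstoD(2)[where y = 0]) (auto simp: o_def)
  \<comment> \<open>For every threshold up to \<open>hi (r0 l)\<close>, a later block must have
    predecessor sets agreeing with their limits below \<open>hi (r0 l)\<close> and be light on these
    limits. These are finitely many eventual conditions.\<close>
  define P where "P l m \<longleftrightarrow> (\<forall>j\<in>{..hi (r0 l)}. \<forall>i\<in>{..<K j}.
      (\<forall>k\<in>{..<hi (r0 l)}. k \<in> T (r0 m) (j, i) \<longleftrightarrow> k \<in> L (j, i)) \<and>
      sq_mass (u (r0 m)) (L (j, i)) < (1/2) ^ j)" for l m
  have "eventually (P l) sequentially" for l
    unfolding P_def by (intro eventually_ball_finite ballI eventually_conj L light) auto
  then obtain r1 :: "nat \<Rightarrow> nat" where r1: "strict_mono r1" "\<And>l n. l < n \<Longrightarrow> P (r1 l) (r1 n)"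
    using strict_mono_of_eventual[of P] by blast
  define r where "r = r0 \<circ> r1"
  have mono: "strict_mono r"
    unfolding r_def using r0 r1(1) by (rule strict_mono_o)
  have "min (sq_mass (u (r l)) s) (sq_mass (u (r n)) s) \<le> (1/2) ^ hi (r k)"
    if kln: "k < l" "l < n" and s: "segment le s" for k l n s
  proof (rule ccontr)
    \<comment> \<open>The pair \<open>k < l\<close> makes block \<open>l\<close> light on the limit
      chains at this threshold; the pair \<open>l < n\<close> makes the predecessor sets of block
      \<open>n\<close> agree with them on the support of block \<open>l\<close>, which requires
      \<open>j \<le> hi (r l)\<close>.\<close>
    define j where "j = hi (r k)"
    assume "\<not> ?thesis"
    then have heavy: "(1/2) ^ j < sq_mass (u (r l)) s" "(1/2) ^ j < sq_mass (u (r n)) s"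
      by (auto simp: j_def)
    have j: "j \<le> hi (r l)"
      unfolding j_def using strict_monoD[OF mono kln(1)] block_seq_hi_strict_mono[OF block]
      by (simp add: strict_mono_less_eq)
    have "Poly_Mapping.keys (u (r n)) \<subseteq> {lo (r n)..}"
      using block_seqD(1)[OF block, of "r n"] by auto
    then obtain t where t: "t \<in> E (r n) j" "\<And>k. k \<in> s \<Longrightarrow> k < lo (r n) \<Longrightarrow> le k t"
      using segment_through_heavy_entry[OF s, of "u (r n)" "lo (r n)" "(1/2) ^ j"] heavy(2)
      unfolding E_def by (auto intro: less_imp_le)
    then obtain i where i: "i < K j" "t = e (r n) j i"
      using e[of "r n" j] by auto
    \<comment> \<open>Block \<open>l\<close> ends before block \<open>n\<close> begins, so its part
      of \<open>s\<close> lies below the entry \<open>t\<close>.\<close>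
    have "Poly_Mapping.keys (u (r l)) \<inter> s \<subseteq> L (j, i)"
    proof
      fix k assume k: "k \<in> Poly_Mapping.keys (u (r l)) \<inter> s"
      then have "k < hi (r l)"
        using block_seqD(1)[OF block, of "r l"] by auto
      moreover have "hi (r l) \<le> lo (r n)"
        using block_seqD(3)[OF block] strict_monoD[OF mono kln(2)] by blast
      ultimately have "k \<in> T (r n) (j, i)"
        using t(2)[of k] k i(2) by (auto simp: T_def)
      then show "k \<in> L (j, i)"
        using r1(2)[OF kln(2)] j i(1) \<open>k < hi (r l)\<close> unfolding P_def r_def by auto
    qed
    then have "sq_mass (u (r l)) s \<le> sq_mass (u (r l)) (L (j, i))"
      by (rule sq_mass_mono)
    moreover have "sq_mass (u (r l)) (L (j, i)) < (1/2) ^ j"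
      using r1(2)[OF kln(1)] i(1) unfolding P_def r_def j_def by auto
    ultimately show False
      using heavy(1) by linarith
  qed
  then have "\<forall>k l n s. k < l \<and> l < n \<and> segment le s \<longrightarrow>
      min (sq_mass (u (r l)) s) (sq_mass (u (r n)) s) \<le> (1/2) ^ hi (r k)"
    by simp
  with mono show ?thesis
    by (intro exI[of _ r] conjI)
qed

section \<open>Gliding hump\<close>

text \<open>The first \<open>m\<close> coordinates of \<open>x n\<close> tend to 0 by weak nullness.
  A finitely supported approximation \<open>w\<close> of \<open>x n\<close> therefore has small
  initial coordinates, which can be removed.\<close>

lemma weakly_null_near_tail:
  fixes J :: "(nat \<Rightarrow>\<^sub>0 real) \<Rightarrow> 'a::banach" and x :: "nat \<Rightarrow> 'a"
  assumes comp: "is_completion (JT_norm le p) J" and null: "weakly_null x" and e: "e > 0"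
  obtains n v where "n0 < n" "Poly_Mapping.keys v \<subseteq> {m..}" "norm (x n - J v) < e"
proof -
  have J: "linear J" "closure (range J) = UNIV"
    using comp by (auto simp: is_completion_def)
  have "\<exists>f. bounded_linear f \<and> (\<forall>y v. \<bar>f y - Poly_Mapping.lookup v i\<bar> \<le> norm (y - J v))" for i
  proof -
    have "linear (\<lambda>v::nat \<Rightarrow>\<^sub>0 real. Poly_Mapping.lookup v i)"
      by (rule linearI) (auto simp: lookup_add lookup_scaleR)
    from bounded_linear_extension_to_completion[OF comp this abs_lookup_le_JT_norm]
    show ?thesis
      by metis
  qed
  then obtain f where f: "\<And>i. bounded_linear (f i)"
    "\<And>i y v. \<bar>f i y - Poly_Mapping.lookup v i\<bar> \<le> norm (y - J v)"
    by metis
  define S where "S = (\<Sum>i<m. norm (J (unit_vec i)))"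
  \<comment> \<open>Approximation costs less than \<open>d\<close>, and removing initial coordinates
    of size at most \<open>2 * d\<close> costs at most \<open>2 * d * S\<close>; together this is
    less than \<open>2 * (S + 1) * d = e\<close>.\<close>
  define d where "d = e / (2 * (S + 1))"
  have S: "0 \<le> S"
    by (simp add: S_def sum_nonneg)
  then have d: "d > 0"
    using e by (simp add: d_def)
  have "eventually (\<lambda>n. \<forall>i\<in>{..<m}. \<bar>f i (x n)\<bar> < d) sequentially"
  proof (intro eventually_ball_finite ballI)
    fix i
    have "(\<lambda>n. f i (x n)) \<longlonglongrightarrow> 0"
      using null f(1) unfolding weakly_null_def by blast
    from tendstoD[OF this d] show "eventually (\<lambda>n. \<bar>f i (x n)\<bar> < d) sequentially"
      by simp
  qed simp
  then have "eventually (\<lambda>n. n0 < n \<and> (\<forall>i\<in>{..<m}. \<bar>f i (x n)\<bar> < d)) sequentially"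
    by (intro eventually_conj eventually_gt_at_top)
  then obtain n where n: "n0 < n" "\<And>i. i < m \<Longrightarrow> \<bar>f i (x n)\<bar> < d"
    by (auto simp: eventually_sequentially)
  have "x n \<in> closure (range J)"
    using J(2) by simp
  then obtain w where w: "norm (x n - J w) < d"
    using d unfolding closure_approachable by (auto simp: dist_norm norm_minus_commute)
  define h where "h = (\<Sum>i<m. Poly_Mapping.lookup w i *\<^sub>R unit_vec i)"
  have h: "Poly_Mapping.lookup h k = (if k < m then Poly_Mapping.lookup w k else 0)" for k
    by (auto simp: h_def lookup_sum scaleR_unit_vec lookup_single when_def)
  have "Poly_Mapping.keys (w - h) \<subseteq> {m..}"
    by (auto simp: in_keys_iff lookup_minus h split: if_splits)
  moreover have "norm (x n - J (w - h)) < e"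
  proof -
    have wi: "\<bar>Poly_Mapping.lookup w i\<bar> \<le> 2 * d" if "i < m" for i
      using n(2)[OF that] f(2)[of i "x n" w] w by linarith
    have "norm (J h) \<le> (\<Sum>i<m. norm (J (Poly_Mapping.lookup w i *\<^sub>R unit_vec i)))"
      unfolding h_def linear_sum[OF J(1)] by (rule norm_sum)
    also have "\<dots> \<le> (\<Sum>i<m. 2 * d * norm (J (unit_vec i)))"
      using wi by (intro sum_mono) (auto simp: linear_scale[OF J(1)] intro!: mult_right_mono)
    also have "\<dots> = 2 * d * S"
      by (simp add: S_def sum_distrib_left)
    finally have "norm (J h) \<le> 2 * d * S" .
    moreover have "norm (x n - J (w - h)) \<le> norm (x n - J w) + norm (J h)"
      using norm_triangle_ineq[of "x n - J w" "J h"] by (simp add: linear_diff[OF J(1)] algebra_simps)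
    ultimately have "norm (x n - J (w - h)) < 2 * (S + 1) * d"
      using w d by (simp add: algebra_simps)
    also have "\<dots> = e"
      using S by (simp add: d_def)
    finally show ?thesis .
  qed
  ultimately show ?thesis
    using n(1) that by blast
qed

lemma weakly_null_near_block_seq:
  fixes J :: "(nat \<Rightarrow>\<^sub>0 real) \<Rightarrow> 'a::banach" and x :: "nat \<Rightarrow> 'a"
  assumes comp: "is_completion (JT_norm le p) J" and null: "weakly_null x"
    and \<epsilon>: "\<And>n. 0 < \<epsilon> n"
  obtains r :: "nat \<Rightarrow> nat" and lo hi u where "strict_mono r" "block_seq lo hi u"
    "\<And>n. norm (x (r n) - J (u n)) < \<epsilon> n"
proof -
  \<comment> \<open>A state of the recursion holds an index of \<open>x\<close>, the ends of an
    interval and the block supported there; \<open>Q\<close> relates consecutive states.\<close>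
  define P where "P k = (\<lambda>(n, a, b, v). Poly_Mapping.keys v \<subseteq> {a..<b} \<and> a < b \<and> norm (x n - J v) < \<epsilon> k)" for k
  define Q where "Q = (\<lambda>(n::nat, a::nat, b::nat, v::nat \<Rightarrow>\<^sub>0 real) (n'::nat, a'::nat, b'::nat, v'::nat \<Rightarrow>\<^sub>0 real). n < n' \<and> b \<le> a')"
  have step: "\<exists>n b v. n0 < n \<and> P k (n, m, b, v)" for k n0 m
  proof -
    obtain n v where nv: "n0 < n" "Poly_Mapping.keys v \<subseteq> {m..}" "norm (x n - J v) < \<epsilon> k"
      using weakly_null_near_tail[OF comp null \<epsilon>] by blast
    obtain b where b: "Poly_Mapping.keys v \<subseteq> {..<b}"
      using finite_nat_iff_bounded[of "Poly_Mapping.keys v"] by auto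
    \<comment> \<open>The maximum keeps the interval nonempty even if \<open>v\<close>
      vanishes.\<close>
    have "Poly_Mapping.keys v \<subseteq> {m..<max b (Suc m)}"
      using nv(2) b by fastforce
    then have "P k (n, m, max b (Suc m), v)"
      using nv(3) by (simp add: P_def)
    with nv(1) show ?thesis
      by blast
  qed
  have "\<exists>z. P 0 z"
    using step by blast
  moreover have "\<exists>z'. P (Suc k) z' \<and> Q z z'" for k z
  proof -
    obtain n a b v where z: "z = (n, a, b, v)"
      by (cases z)
    obtain n' b' v' where "n < n'" "P (Suc k) (n', b, b', v')"
      using step by blast
    then show ?thesis
      by (intro exI[of _ "(n', b, b', v')"]) (simp add: Q_def z)
  qed
  ultimately obtain z where z: "\<And>k. P k (z k)" "\<And>k. Q (z k) (z (Suc k))"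
    using dependent_nat_choice[of P "\<lambda>_. Q"] by metis
  define r where "r k = fst (z k)" for k
  define lo where "lo k = fst (snd (z k))" for k
  define hi where "hi k = fst (snd (snd (z k)))" for k
  define u where "u k = snd (snd (snd (z k)))" for k
  have zk: "z k = (r k, lo k, hi k, u k)" for k
    by (simp add: r_def lo_def hi_def u_def)
  have P: "Poly_Mapping.keys (u k) \<subseteq> {lo k..<hi k}" "lo k < hi k" "norm (x (r k) - J (u k)) < \<epsilon> k" for k
    using z(1)[of k] by (auto simp: P_def zk)
  have Q: "r k < r (Suc k)" "hi k \<le> lo (Suc k)" for k
    using z(2)[of k] by (auto simp: Q_def zk)
  have "hi m \<le> lo n" if "m < n" for m n
    using that
  proof (induction n)
    case (Suc n)
    then show ?case
      using Q(2)[of n] P(2)[of n] by (cases "m = n") auto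
  qed simp
  then have "block_seq lo hi u"
    using P by (simp add: block_seq_def)
  moreover have "strict_mono r"
    using Q(1) by (simp add: strict_mono_Suc_iff)
  ultimately show ?thesis
    using that P(3) by blast
qed

end

section \<open>The dichotomy for masses on chains\<close>

theorem corollary1p3p12:
  fixes le :: "nat \<Rightarrow> nat \<Rightarrow> bool"
    and p :: real
    and J :: "(nat \<Rightarrow>\<^sub>0 real) \<Rightarrow> 'a::banach"
    and x :: "nat \<Rightarrow> 'a"
  assumes "tree_order le"
    and "2 < p"
    and "is_completion (JT_norm le p) J"
    and "\<And>n. norm (x n) = 1"
    and "weakly_null x"
  shows "\<exists>r. strict_mono r \<and>
           (equivalent_seqs norm (x \<circ> r) (lq_norm p) unit_vec \<or>
            equivalent_seqs norm (x \<circ> r) (lq_norm 2) unit_vec)"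
proof -
  interpret James_tree le p
    using assms(1,2) by unfold_locales
  have J: "linear J" "\<And>v. norm (J v) = JT_norm le p v"
    using assms(3) by (auto simp: is_completion_def)
  obtain r0 lo hi u where r0: "strict_mono r0" and block: "block_seq lo hi u"
    \<comment> \<open>The errors sum to at most \<open>1/8\<close>, within the \<open>1/4\<close>
      that the perturbation argument allows for \<open>c = 1/2\<close>; each is small enough for the
      bounds \<open>1/2\<close> and 2 on the norms of the blocks.\<close>
    and near: "\<And>n. norm (x (r0 n) - J (u n)) < (1/2) ^ n / 16"
    by (rule weakly_null_near_block_seq[OF assms(3,5), of "\<lambda>n. (1/2) ^ n / 16"]) auto
  have norm_u: "1/2 < JT_norm le p (u n)" "JT_norm le p (u n) \<le> 2" for n
  proof -
    have "(1/2::real) ^ n \<le> 1"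
      by (simp add: power_le_one)
    then have "norm (x (r0 n) - J (u n)) < 1/16"
      using near[of n] by linarith
    then have "\<bar>norm (x (r0 n)) - norm (J (u n))\<bar> < 1/16"
      by (meson le_less_trans norm_triangle_ineq3)
    then show "1/2 < JT_norm le p (u n)" "JT_norm le p (u n) \<le> 2"
      using assms(4)[of "r0 n"] J(2)[of "u n"] by linarith+
  qed
  have norm_comb: "norm (\<Sum>n\<in>Poly_Mapping.keys a. Poly_Mapping.lookup a n *\<^sub>R (J \<circ> (u \<circ> r)) n) =
      JT_norm le p (lin_comb a (u \<circ> r))" for a r
    by (simp add: lin_comb_def linear_sum[OF J(1)] linear_scale[OF J(1)] flip: J(2))
  have err: "(\<Sum>n\<in>F. norm ((x \<circ> (r0 \<circ> r)) n - (J \<circ> (u \<circ> r)) n)) \<le> (1/2) ^ m / 8"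
    if "strict_mono r" "m \<le> r 0" "finite F" for r :: "nat \<Rightarrow> nat" and m F
  proof -
    have "(\<Sum>n\<in>F. norm ((x \<circ> (r0 \<circ> r)) n - (J \<circ> (u \<circ> r)) n)) \<le> (\<Sum>n\<in>F. (1/2) ^ r n / 16)"
      using near by (intro sum_mono) (auto intro: less_imp_le)
    also have "\<dots> \<le> (1/2) ^ m / 8"
      using sum_geometric_subseq_le[OF that] by (simp flip: sum_divide_distrib)
    finally show ?thesis .
  qed
  show ?thesis
  proof (cases "\<forall>T. chain_set T \<longrightarrow> (\<lambda>n. sq_mass (u n) T) \<longlonglongrightarrow> 0")
    case True
    then have null: "(\<lambda>n. sq_mass (u n) T) \<longlonglongrightarrow> 0" if "chain_set T" for T
      using that by blast
    obtain r :: "nat \<Rightarrow> nat" where r: "strict_mono r" and sep: "\<And>k l n s. k < l \<Longrightarrow> l < n \<Longrightarrow> segment le s \<Longrightarrow>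
        min (sq_mass (u (r l)) s) (sq_mass (u (r n)) s) \<le> (1/2) ^ hi (r k)"
      using separated_subseq[OF block norm_u(2) null] by auto
    have block': "block_seq (lo \<circ> r) (hi \<circ> r) (u \<circ> r)"
      by (rule block_seq_subseq[OF block r])
    obtain D where D: "D > 0" "\<And>a. JT_norm le p (lin_comb a (u \<circ> r)) \<le> D * lq_norm p a"
      using upper_lp_estimate[OF block', of 2] norm_u(2) sep by auto
    have "equivalent_seqs norm (x \<circ> (r0 \<circ> r)) (lq_norm p) unit_vec"
    proof (rule equivalent_seqs_perturbation[where y = "J \<circ> (u \<circ> r)" and c = "1/2" and D = D])
      show "(\<Sum>n\<in>F. norm ((x \<circ> (r0 \<circ> r)) n - (J \<circ> (u \<circ> r)) n)) \<le> 1/2/2" if "finite F" for F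
        using err[OF r _ that, of 0] by simp
      show "1/2 * lq_norm p a \<le> norm (\<Sum>n\<in>Poly_Mapping.keys a. Poly_Mapping.lookup a n *\<^sub>R (J \<circ> (u \<circ> r)) n)" for a
        unfolding norm_comb using norm_u(1) by (intro lower_lp_estimate[OF block']) auto
    qed (use assms(2) D in \<open>auto simp only: norm_comb\<close>)
    then show ?thesis
      using strict_mono_o[OF r0 r] by blast
  next
    case False
    then obtain T where T: "chain_set T" "\<not> (\<lambda>n. sq_mass (u n) T) \<longlonglongrightarrow> 0"
      by blast
    then obtain d where d: "d > 0" "\<not> eventually (\<lambda>n. sq_mass (u n) T < d) sequentially"
      unfolding tendsto_iff by auto
    have "(\<lambda>m. (1/2::real) ^ m) \<longlonglongrightarrow> 0"
      by (rule LIMSEQ_realpow_zero) auto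
    then have "eventually (\<lambda>m. (1/2) ^ m < sqrt d) sequentially"
      using d(1) by (intro order_tendstoD(2)[where y = 0]) auto
    \<comment> \<open>The lower constant \<open>sqrt d\<close> may be small, so the subsequence
      starts at \<open>m\<close> or later, where the total error is at most
      \<open>sqrt d / 2\<close>.\<close>
    then obtain m :: nat where m: "(1/2) ^ m < sqrt d"
      by (auto simp: eventually_sequentially)
    define M where "M = {n. m \<le> n \<and> d \<le> sq_mass (u n) T}"
    have "infinite M"
      unfolding infinite_nat_iff_unbounded_le
    proof
      fix k
      obtain n where "n \<ge> max k m" "\<not> sq_mass (u n) T < d"
        using d(2) unfolding eventually_sequentially by blast
      then show "\<exists>n\<ge>k. n \<in> M"
        unfolding M_def by (intro exI[of _ n]) auto
    qed
    define r where "r = enumerate M"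
    have r: "strict_mono r"
      unfolding r_def by (rule strict_mono_enumerate[OF \<open>infinite M\<close>])
    have rM: "r n \<in> M" for n
      unfolding r_def by (rule enumerate_in_set[OF \<open>infinite M\<close>])
    have block': "block_seq (lo \<circ> r) (hi \<circ> r) (u \<circ> r)"
      by (rule block_seq_subseq[OF block r])
    have "equivalent_seqs norm (x \<circ> (r0 \<circ> r)) (lq_norm 2) unit_vec"
    proof (rule equivalent_seqs_perturbation[where y = "J \<circ> (u \<circ> r)" and c = "sqrt d" and D = 2])
      show "(\<Sum>n\<in>F. norm ((x \<circ> (r0 \<circ> r)) n - (J \<circ> (u \<circ> r)) n)) \<le> sqrt d / 2" if "finite F" for F
      proof -
        have "m \<le> r 0"
          using rM[of 0] by (simp add: M_def)
        note err[OF r this that]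
        also have "(1/2) ^ m / 8 \<le> sqrt d / 2"
          using m real_sqrt_gt_zero[OF d(1)] by linarith
        finally show ?thesis .
      qed
      show "sqrt d * lq_norm 2 a \<le> norm (\<Sum>n\<in>Poly_Mapping.keys a. Poly_Mapping.lookup a n *\<^sub>R (J \<circ> (u \<circ> r)) n)" for a
        unfolding norm_comb using d(1) rM by (intro lower_l2_estimate[OF block' T(1)]) (auto simp: M_def)
      show "norm (\<Sum>n\<in>Poly_Mapping.keys a. Poly_Mapping.lookup a n *\<^sub>R (J \<circ> (u \<circ> r)) n) \<le> 2 * lq_norm 2 a" for a
        unfolding norm_comb by (rule upper_l2_estimate[OF block']) (simp add: norm_u)
    qed (use d(1) in auto)
    then show ?thesis
      using strict_mono_o[OF r0 r] by blast
  qed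
qed

end
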